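(* Let $\rho$ and $W_\rho$ be as in the context, with generalized coherent states $|z;\rho\rangle$ in $H$ and generalized Bargmann space $\mathcal{B}(W_\rho)$. Suppose there are real numbers $\mathfrak{a}=\mathfrak{a}(\rho)>0$ and $\mathfrak{b}=\mathfrak{b}(\rho)>0$ such that $$W_\rho(|z|^2)\sim \exp\left[-2\mathfrak{b}\,|z|^{\mathfrak{a}}\right]\quad\text{as } |z|\to\infty,$$ where $\sim$ means log-asymptotic, i.e. $\displaystyle\lim_{|z|\to\infty}\frac{\ln W_\rho(|z|^2)}{-2\mathfrak{b}|z|^{\mathfrak{a}}}=1$. Then: (1) The set of functions in the generalized Bargmann space satisfies $$\mathfrak{B}_1(\mathfrak{a},\mathfrak{b})\subset \mathcal{B}(W_\rho)\subset \mathfrak{B}(\mathfrak{a},\mathfrak{b}).$$ Functions with order of growth $\mathfrak{a}$ and type $\mathfrak{b}$ might or might not belong to $\mathcal{B}(W_\rho)$. (2) Let $\{z_N\}$ be a sequence of complex numbers with density $(t,\delta)$. The set of generalized coherent states $|z_N;\rho\rangle$ is overcomplete in $H$ when $(t,\delta)\succ(\mathfrak{a},\mathfrak{b}\mathfrak{a})$, and it is undercomplete in $H$ when $t<\mathfrak{a}$.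
   Context: **Generalized coherent states.** $H$ is a complex separable Hilbert space with orthonormal basis $\{|n\rangle\}_{n\ge 0}$. $\rho:\{0,1,2,\dots\}\to(0,\infty)$ is a function with $\rho(0)=1$ such that $\mathcal{N}_\rho(x)=\sum_{n=0}^\infty x^n/\rho(n)$ converges for all $x\ge 0$. For $z\in\mathbb{C}$ the generalized coherent state is $$|z;\rho\rangle=[\mathcal{N}_\rho(|z|^2)]^{-1/2}\sum_{n=0}^\infty \frac{z^n}{\rho(n)^{1/2}}|n\rangle .$$ It is assumed that there is a function $W_\rho:(0,\infty)\to(0,\infty)$ with $\int_0^\infty x^n W_\rho(x)\,dx=\rho(n)$ for all $n\ge 0$. **Generalized Bargmann space.** A state $|f\rangle=\sum_n f_n|n\rangle\in H$ is represented by the entire function $F(z;\rho)=[\mathcal{N}_\rho(|z|^2)]^{1/2}\langle z^*;\rho|f\rangle=\sum_{n=0}^\infty f_n z^n/\rho(n)^{1/2}$, where $z^*$ is the complex conjugate of $z$. The space $\mathcal{B}(W_\rho)$ consists of all entire functions $F$ for which $(F,F)$ is finite, with scalar product $$(G,F)=\int_{\mathbb{C}}\frac{d^2z}{\pi}\,W_\rho(|z|^2)\,\overline{G(z)}\,F(z),$$ where $d^2z$ is Lebesgue measure on the plane. **Growth.** For an entire function $f$ let $M(R)=\max_{|z|=R}|f(z)|$. Its order is $r=\limsup_{R\to\infty}\frac{\ln\ln M(R)}{\ln R}$ and its type (for order $r$) is $s=\limsup_{R\to\infty}\frac{\ln M(R)}{R^r}$; constant functions (including $0$) are regarded as having order $0$.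 $\mathfrak{B}(r,s)$ is the set of entire functions that have order smaller than $r$, or have order $r$ and type $\le s$; $\mathfrak{B}_1(r,s)$ is the set of entire functions that have order smaller than $r$, or have order $r$ and type $<s$. **Density of a sequence.** Let $\zeta_1,\zeta_2,\dots$ be a sequence of complex numbers with $0<|\zeta_1|\le|\zeta_2|\le\cdots$ and $|\zeta_N|\to\infty$. Let $n(R)$ be the number of terms of the sequence within the circle $|z|<R$. The sequence has density $(t,\delta)$ if $t=\limsup_{R\to\infty}\frac{\ln n(R)}{\ln R}$ and $\delta=\lim_{R\to\infty}\frac{n(R)}{R^t}$ (it is assumed throughout that this limit exists). Adding or removing finitely many complex numbers does not change the density. Densities are ordered lexicographically: $(t,\delta)\prec(t_1,\delta_1)$ if $t<t_1$, or $t=t_1$ and $\delta<\delta_1$; and $(t,\delta)\succ(t_1,\delta_1)$ means $(t_1,\delta_1)\prec(t,\delta)$. **Completeness notions.** A set $\mathfrak{S}$ of states in $H$ is total if there is no state (nonzero vector) in $H$ orthogonal to all states in $\mathfrak{S}$; it is undercomplete if there is a state (nonzero vector) in $H$ orthogonal to all states in $\mathfrak{S}$; it is overcomplete if it is total and there is at least one $|u\rangle\in\mathfrak{S}$ such that $\mathfrak{S}\setminus\{|u\rangle\}$ is also total.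
   Formalization: In the overcompleteness claim the z_N are assumed pairwise distinct; density counts terms with repetition while the set of coherent states ignores it, so repeating the points of a sparse sequence often enough makes the claim false. *)

theory Defs
  imports "HOL-Complex_Analysis.Complex_Analysis"
begin

section \<open>Complex Hilbert space with an orthonormal basis\<close>

text \<open>The inner product is linear in the second argument (bra-ket convention). Completeness of the
  space is the type class constraint, and the norm is required to be the one induced by the inner
  product. Separability follows from the existence of the countable basis.\<close>

locale complex_hilbert_onb =
  vector_space scaleC
  for scaleC :: "complex \<Rightarrow> 'h::banach \<Rightarrow> 'h" +
  fixes cinner :: "'h \<Rightarrow> 'h \<Rightarrow> complex"
    and e :: "nat \<Rightarrow> 'h"
  assumes scaleC_of_real: "scaleC (complex_of_real r) x = r *\<^sub>R x"
    and cinner_commute: "cinner x y = cnj (cinner y x)"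
    and cinner_add_right: "cinner x (y + z) = cinner x y + cinner x z"
    and cinner_scaleC_right: "cinner x (scaleC c y) = c * cinner x y"
    and norm_eq_sqrt_cinner: "norm x = sqrt (Re (cinner x x))"
    and orthonormal: "cinner (e m) (e n) = (if m = n then 1 else 0)"
    and dense_span: "closure (module.span scaleC (range e)) = UNIV"

definition total_states :: "('h::banach \<Rightarrow> 'h \<Rightarrow> complex) \<Rightarrow> 'h set \<Rightarrow> bool" where
  "total_states cinner S \<longleftrightarrow> \<not> (\<exists>f. f \<noteq> 0 \<and> (\<forall>s\<in>S. cinner s f = 0))"

definition undercomplete :: "('h::banach \<Rightarrow> 'h \<Rightarrow> complex) \<Rightarrow> 'h set \<Rightarrow> bool" where
  "undercomplete cinner S \<longleftrightarrow> (\<exists>f. f \<noteq> 0 \<and> (\<forall>s\<in>S. cinner s f = 0))"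

definition overcomplete :: "('h::banach \<Rightarrow> 'h \<Rightarrow> complex) \<Rightarrow> 'h set \<Rightarrow> bool" where
  "overcomplete cinner S \<longleftrightarrow>
     total_states cinner S \<and> (\<exists>u\<in>S. total_states cinner (S - {u}))"


section \<open>Generalized coherent states\<close>

definition coherent_norm :: "(nat \<Rightarrow> real) \<Rightarrow> real \<Rightarrow> real" where
  "coherent_norm \<rho> x = (\<Sum>n. x ^ n / \<rho> n)"

definition coherent_state ::
    "(complex \<Rightarrow> 'h::banach \<Rightarrow> 'h) \<Rightarrow> (nat \<Rightarrow> 'h) \<Rightarrow> (nat \<Rightarrow> real) \<Rightarrow> complex \<Rightarrow> 'h" where
  "coherent_state scaleC e \<rho> z =
     scaleC (complex_of_real (coherent_norm \<rho> ((cmod z)\<^sup>2) powr (- 1 / 2)))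
       (\<Sum>n. scaleC (z ^ n / complex_of_real (sqrt (\<rho> n))) (e n))"


section \<open>Generalized Bargmann space\<close>

text \<open>The integrand of the scalar product \<open>(G, F)\<close> with respect to planar Lebesgue measure. The
  value of the weight at \<open>0\<close>, where it is not prescribed, matters only on a null set.\<close>

definition bargmann_integrand ::
    "(real \<Rightarrow> real) \<Rightarrow> (complex \<Rightarrow> complex) \<Rightarrow> (complex \<Rightarrow> complex) \<Rightarrow> complex \<Rightarrow> complex" where
  "bargmann_integrand W G F z = complex_of_real (W ((cmod z)\<^sup>2) / pi) * cnj (G z) * F z"

definition bargmann_space :: "(real \<Rightarrow> real) \<Rightarrow> (complex \<Rightarrow> complex) set" where
  "bargmann_space W =
     {F. F holomorphic_on UNIV \<and> integrable lebesgue (bargmann_integrand W F F)}"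


section \<open>Growth of entire functions\<close>

definition max_modulus :: "(complex \<Rightarrow> complex) \<Rightarrow> real \<Rightarrow> real" where
  "max_modulus f R = (SUP z\<in>sphere 0 R. cmod (f z))"

definition growth_order :: "(complex \<Rightarrow> complex) \<Rightarrow> ereal" where
  "growth_order f =
     (if f constant_on UNIV then 0
      else Limsup at_top (\<lambda>R. ereal (ln (ln (max_modulus f R)) / ln R)))"

definition growth_type :: "real \<Rightarrow> (complex \<Rightarrow> complex) \<Rightarrow> ereal" where
  "growth_type r f = Limsup at_top (\<lambda>R. ereal (ln (max_modulus f R) / R powr r))"

definition growth_le :: "real \<Rightarrow> real \<Rightarrow> (complex \<Rightarrow> complex) set" where
  "growth_le r s =
     {f. f holomorphic_on UNIV \<and>
         (growth_order f < ereal r \<or> growth_order f = ereal r \<and> growth_type r f \<le> ereal s)}"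

definition growth_less :: "real \<Rightarrow> real \<Rightarrow> (complex \<Rightarrow> complex) set" where
  "growth_less r s =
     {f. f holomorphic_on UNIV \<and>
         (growth_order f < ereal r \<or> growth_order f = ereal r \<and> growth_type r f < ereal s)}"


section \<open>Density of a sequence\<close>

definition count_below :: "(nat \<Rightarrow> complex) \<Rightarrow> real \<Rightarrow> nat" where
  "count_below \<zeta> R = card {N. cmod (\<zeta> N) < R}"

text \<open>Terms are counted with repetition. The limit \<open>\<delta>\<close> is taken in the extended reals.\<close>

definition has_density :: "(nat \<Rightarrow> complex) \<Rightarrow> real \<times> ereal \<Rightarrow> bool" where
  "has_density \<zeta> = (\<lambda>(t, \<delta>).
     0 < cmod (\<zeta> 0) \<and> incseq (\<lambda>N. cmod (\<zeta> N)) \<and>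
     filterlim (\<lambda>N. cmod (\<zeta> N)) at_top sequentially \<and>
     Limsup at_top (\<lambda>R. ereal (ln (real (count_below \<zeta> R)) / ln R)) = ereal t \<and>
     ((\<lambda>R. ereal (real (count_below \<zeta> R) / R powr t)) \<longlongrightarrow> \<delta>) at_top)"

definition density_less :: "real \<times> ereal \<Rightarrow> real \<times> ereal \<Rightarrow> bool" where
  "density_less = (\<lambda>(t, \<delta>) (t1, \<delta>1). t < t1 \<or> t = t1 \<and> \<delta> < \<delta>1)"

end

theory Submission
  imports Defs "HOL-Real_Asymp.Real_Asymp"
begin

text \<open>
  Only two estimates of the moments \<open>\<rho>(n)\<close> are needed. Since \<open>W\<close> decays like
  \<open>exp (-2 \<bb> x\<^bsup>\<aa>/2\<^esup>)\<close>, the integral of \<open>W(x) exp (2 s x\<^bsup>\<aa>/2\<^esup>)\<close> is finite for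
  \<open>s < \<bb>\<close>; integrating over \<open>[r\<^sup>2, r\<^sup>2 + 1]\<close> only gives
  \<open>r\<^sup>n \<le> C exp (s r\<^bsup>\<aa>\<^esup>) \<rho>(n)\<^bsup>1/2\<^esup>\<close> for \<open>s > \<bb>\<close>. The first shows that functions of smaller
  growth are square integrable. For the converse, \<open>W(|z|\<^sup>2) d\<^sup>2z\<close> is invariant under rotations, so
  averaging over roots of unity and Fatou's lemma give \<open>|c\<^sub>n|\<^sup>2 \<rho>(n) \<le> (F, F)\<close> for
  \<open>F = \<Sum> c\<^sub>n z\<^sup>n\<close>, and the second estimate bounds \<open>F\<close>. The coefficients
  \<open>(n + 1) \<rho>(n)\<^bsup>-1/2\<^esup>\<close> and \<open>(n + 1)\<^bsup>-2\<^esup> \<rho>(n)\<^bsup>-1/2\<^esup>\<close> yield functions of critical growth outside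
  and inside the space.

  A vector \<open>f\<close> is orthogonal to \<open>|z; \<rho>\<rangle>\<close> iff the entire function with coefficients
  \<open>\<langle>f|n\<rangle> \<rho>(n)\<^bsup>-1/2\<^esup>\<close> vanishes at \<open>z\<close>. By Jensen's inequality such a function
  cannot have too dense a set of zeros, even if one of them is omitted. Conversely a sequence of
  order below \<open>\<aa>\<close> is contained in the zero set of a product of small growth,
  whose rescaled coefficients form the required orthogonal vector.
\<close>

section \<open>Order and type versus pointwise bounds\<close>

text \<open>The working form of order and type: one bound valid on the whole plane, so that no upper
  limits have to be handled later. The type comes first and the order second, opposite to
  \<open>growth_le\<close> and \<open>growth_less\<close>, and \<open>C\<close> carries no sign
  condition.\<close>

definition exp_bounded :: "real \<Rightarrow> real \<Rightarrow> (complex \<Rightarrow> complex) \<Rightarrow> bool" where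
  "exp_bounded s r f \<longleftrightarrow> (\<exists>C. \<forall>z. cmod (f z) \<le> C * exp (s * cmod z powr r))"

text \<open>Compactness bounds \<open>f\<close> on the disc of radius \<open>R0\<close>. Since
  \<open>s \<ge> 0\<close>, the exponential is at least 1 there, so this bound can be added to the
  constant.\<close>

lemma exp_boundedI_eventually:
  assumes f: "continuous_on UNIV f" and "s \<ge> 0"
    and "\<And>z. cmod z \<ge> R0 \<Longrightarrow> cmod (f z) \<le> C * exp (s * cmod z powr r)"
  shows "exp_bounded s r f"
proof -
  have "compact (f ` cball 0 R0)"
    by (rule compact_continuous_image) (use f continuous_on_subset in auto)
  then obtain B where B: "\<And>z. cmod z \<le> R0 \<Longrightarrow> cmod (f z) \<le> B"
    by (metis (no_types, lifting) bounded_iff compact_imp_bounded imageI mem_cball_0)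
  have "cmod (f z) \<le> (\<bar>B\<bar> + \<bar>C\<bar>) * exp (s * cmod z powr r)" for z
  proof (cases "cmod z \<ge> R0")
    case True
    have "C * exp (s * cmod z powr r) \<le> (\<bar>B\<bar> + \<bar>C\<bar>) * exp (s * cmod z powr r)"
      by (intro mult_right_mono) auto
    with assms(3)[OF True] show ?thesis by linarith
  next
    case False
    then have "cmod (f z) \<le> \<bar>B\<bar> + \<bar>C\<bar>" using B[of z] by auto
    also have "\<dots> \<le> (\<bar>B\<bar> + \<bar>C\<bar>) * exp (s * cmod z powr r)"
      using \<open>s \<ge> 0\<close> by (intro mult_le_cancel_left1[THEN iffD2]) auto
    finally show ?thesis .
  qed
  then show ?thesis unfolding exp_bounded_def by blast
qed

lemma max_modulus_upper:
  assumes "continuous_on UNIV f"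
  shows "cmod (f z) \<le> max_modulus f (cmod z)"
proof -
  have "compact ((\<lambda>z. cmod (f z)) ` sphere 0 (cmod z))"
    by (intro compact_continuous_image continuous_intros)
       (use assms continuous_on_subset in auto)
  then have "bdd_above ((\<lambda>z. cmod (f z)) ` sphere 0 (cmod z))"
    by (simp add: bounded_imp_bdd_above compact_imp_bounded)
  then show ?thesis unfolding max_modulus_def by (rule cSUP_upper2) auto
qed

lemma max_modulus_least:
  assumes "R \<ge> 0" "\<And>z. cmod z = R \<Longrightarrow> cmod (f z) \<le> B"
  shows "max_modulus f R \<le> B"
  unfolding max_modulus_def using assms by (intro cSUP_least) auto

lemma max_modulus_principle:
  assumes f: "f holomorphic_on UNIV" and "cmod z \<le> R"
  shows "cmod (f z) \<le> max_modulus f R"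
proof (cases "R = 0")
  case True
  then show ?thesis using assms max_modulus_upper[of f z] holomorphic_on_imp_continuous_on[OF f]
    by auto
next
  case False
  then have "R > 0" using assms(2) norm_ge_zero[of z] by linarith
  have c: "continuous_on UNIV f" using f holomorphic_on_imp_continuous_on by blast
  show ?thesis
  proof (rule maximum_modulus_frontier[of f "cball 0 R"])
    show "f holomorphic_on interior (cball 0 R)" using f holomorphic_on_subset by blast
    show "continuous_on (closure (cball 0 R)) f" using c continuous_on_subset by blast
    show "cmod (f w) \<le> max_modulus f R" if "w \<in> frontier (cball 0 R)" for w
      using that max_modulus_upper[OF c, of w] \<open>R > 0\<close> by (auto simp: frontier_def)
  qed (use assms in auto)
qed

text \<open>Liouville gives one point where \<open>f\<close> is large, and the maximum principle
  transfers the value to all larger radii. Hence \<open>ln (ln (max_modulus f R))\<close> is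
  eventually a genuine iterated logarithm.\<close>

lemma max_modulus_unbounded:
  assumes f: "f holomorphic_on UNIV" and nc: "\<not> f constant_on UNIV"
  shows "filterlim (max_modulus f) at_top at_top"
  unfolding filterlim_at_top
proof
  fix K :: real
  have "\<not> bounded (range f)" using Liouville_theorem[OF f] nc by blast
  then obtain z where "cmod (f z) > K" unfolding bounded_iff by (auto simp: not_le)
  then have "K \<le> max_modulus f R" if "R \<ge> cmod z" for R
    using max_modulus_principle[OF f that] by linarith
  then show "\<forall>\<^sub>F R in at_top. K \<le> max_modulus f R"
    using eventually_at_top_linorder by blast
qed

text \<open>Strictness leaves room below \<open>b\<close>. For order below \<open>a\<close> every
  positive \<open>s\<close> would do and \<open>b/2\<close> is taken; for order \<open>a\<close> a
  number between the type and \<open>b\<close> is used.\<close>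

lemma growth_less_imp_exp_bounded:
  assumes f: "f \<in> growth_less a b" and "a > 0" "b > 0"
  obtains s where "0 < s" "s < b" "exp_bounded s a f"
proof (cases "f constant_on UNIV")
  case True
  then obtain c where "\<And>z. f z = c" by (auto simp: constant_on_def)
  then have "exp_bounded (b/2) a f"
    unfolding exp_bounded_def using \<open>b > 0\<close>
    by (intro exI[of _ "cmod c"]) (auto intro!: mult_le_cancel_left1[THEN iffD2])
  then show ?thesis using that[of "b/2"] \<open>b > 0\<close> by auto
next
  case False
  have hol: "f holomorphic_on UNIV" using f by (simp add: growth_less_def)
  then have c: "continuous_on UNIV f" using holomorphic_on_imp_continuous_on by blast
  define M where "M = max_modulus f"
  have M: "\<forall>\<^sub>F R in at_top. M R > exp 1"
    using max_modulus_unbounded[OF hol False] by (auto simp: filterlim_at_top_dense M_def)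
  have "\<exists>s. 0 < s \<and> s < b \<and> (\<forall>\<^sub>F R in at_top. ln (M R) \<le> s * R powr a)"
  proof (cases "growth_order f < ereal a")
    case True
    then obtain a' where a': "growth_order f < ereal a'" "a' < a"
      using ereal_dense2 by fastforce
    then have "Limsup at_top (\<lambda>R. ereal (ln (ln (M R)) / ln R)) < ereal a'"
      using False by (simp add: growth_order_def M_def)
    then have 1: "\<forall>\<^sub>F R in at_top. ln (ln (M R)) / ln R < a'"
      by (auto dest: Limsup_lessD)
    have 2: "\<forall>\<^sub>F R in at_top. R powr a' < (b/2) * R powr a"
      using \<open>a' < a\<close> \<open>b > 0\<close> by real_asymp
    have "\<forall>\<^sub>F R in at_top. ln (M R) \<le> (b/2) * R powr a"
      using 1 2 M eventually_gt_at_top[of 1]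
    proof eventually_elim
      case (elim R)
      have "ln (M R) > 0" using elim(3) by (smt (verit) exp_gt_one ln_gt_zero)
      then have "ln (M R) = exp (ln (ln (M R)))" by simp
      also have "\<dots> \<le> exp (a' * ln R)"
        using elim by (simp add: field_simps)
      also have "\<dots> = R powr a'" using elim by (simp add: powr_def)
      finally show ?case using elim by linarith
    qed
    then show ?thesis using \<open>b > 0\<close> by (intro exI[of _ "b/2"]) auto
  next
    case False
    then have "growth_type a f < ereal b" using f by (auto simp: growth_less_def)
    then have "Limsup at_top (\<lambda>R. ereal (ln (M R) / R powr a)) < ereal b"
      by (simp add: growth_type_def M_def)
    then obtain s' where s': "Limsup at_top (\<lambda>R. ereal (ln (M R) / R powr a)) < ereal s'" "s' < b"
      using ereal_dense2 by fastforce
    \<comment> \<open>The number \<open>s'\<close> found between the type and \<open>b\<close> may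
      fail to be positive; the maximum keeps it below \<open>b\<close> and makes it
      positive.\<close>
    define s where "s = max s' (b/2)"
    have "ereal s' \<le> ereal s" by (simp add: s_def)
    with s' have s: "Limsup at_top (\<lambda>R. ereal (ln (M R) / R powr a)) < ereal s" "0 < s" "s < b"
      using \<open>b > 0\<close> less_le_trans by (blast, auto simp: s_def)
    then have "\<forall>\<^sub>F R in at_top. ln (M R) / R powr a < s" by (auto dest: Limsup_lessD)
    then have "\<forall>\<^sub>F R in at_top. ln (M R) \<le> s * R powr a"
      using eventually_gt_at_top[of 0] by eventually_elim (simp add: field_simps)
    then show ?thesis using s by blast
  qed
  then obtain s where s: "0 < s" "s < b" "\<forall>\<^sub>F R in at_top. ln (M R) \<le> s * R powr a" by blast
  from s(3) M have "\<forall>\<^sub>F R in at_top. M R \<le> exp (s * R powr a)"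
  proof eventually_elim
    case (elim R)
    then have "M R > 0" by (smt (verit) exp_gt_zero)
    with elim show ?case by (metis exp_le_cancel_iff exp_ln)
  qed
  then obtain R0 where R0: "\<And>R. R \<ge> R0 \<Longrightarrow> M R \<le> exp (s * R powr a)"
    by (auto simp: eventually_at_top_linorder)
  have bd: "exp_bounded s a f"
  proof (rule exp_boundedI_eventually[OF c])
    show "cmod (f z) \<le> 1 * exp (s * cmod z powr a)" if "cmod z \<ge> R0" for z
      using R0[OF that] max_modulus_upper[OF c, of z] by (simp add: M_def)
  qed (use s in auto)
  show ?thesis by (rule that[OF s(1,2) bd])
qed

text \<open>Logarithms of the bound give \<open>ln M(R) \<le> c + s R^a\<close>. The single value
  \<open>s = b + 1\<close> already limits the order to \<open>a\<close>; letting \<open>s\<close>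
  decrease to \<open>b\<close> limits the type.\<close>

lemma exp_bounded_imp_growth_le:
  assumes hol: "f holomorphic_on UNIV" and "a > 0" "b > 0"
    and bd: "\<And>s. s > b \<Longrightarrow> exp_bounded s a f"
  shows "f \<in> growth_le a b"
proof (cases "f constant_on UNIV")
  case True
  then show ?thesis using hol \<open>a > 0\<close> by (simp add: growth_le_def growth_order_def)
next
  case False
  define M where "M = max_modulus f"
  have M: "\<forall>\<^sub>F R in at_top. M R > exp 1"
    using max_modulus_unbounded[OF hol False] by (auto simp: filterlim_at_top_dense M_def)
  have *: "\<exists>c. \<forall>\<^sub>F R in at_top. ln (M R) \<le> c + s * R powr a" if sb: "s > b" for s
  proof -
    obtain C where C: "\<And>z. cmod (f z) \<le> C * exp (s * cmod z powr a)"
      using bd[OF sb] by (auto simp: exp_bounded_def)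
    have "\<forall>\<^sub>F R in at_top. ln (M R) \<le> ln C + s * R powr a"
      using M eventually_gt_at_top[of 0]
    proof eventually_elim
      case (elim R)
      have le: "M R \<le> C * exp (s * R powr a)" unfolding M_def
        using elim by (intro max_modulus_least) (use C in force)+
      have "M R > 0" using elim by (smt (verit) exp_gt_zero)
      \<comment> \<open>The sign of \<open>C\<close> is not part of \<open>exp_bounded\<close>; it
        follows from the positivity of \<open>M R\<close>.\<close>
      moreover from this le have "C > 0" by (smt (verit) exp_gt_zero zero_less_mult_pos2)
      ultimately have "ln (M R) \<le> ln (C * exp (s * R powr a))" using le by simp
      then show ?case using \<open>C > 0\<close> by (simp add: ln_mult)
    qed
    then show ?thesis by blast
  qed
  have "growth_order f \<le> ereal a"
  proof -
    obtain c where c: "\<forall>\<^sub>F R in at_top. ln (M R) \<le> c + (b + 1) * R powr a"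
      using *[of "b + 1"] by auto
    have "\<forall>\<^sub>F R in at_top. ereal (ln (ln (M R)) / ln R) \<le> ereal (ln (c + (b + 1) * R powr a) / ln R)"
      using c M eventually_gt_at_top[of 1]
    proof eventually_elim
      case (elim R)
      have "ln (M R) > 1" using elim(2)
        by (smt (verit) exp_gt_zero exp_ln exp_less_cancel_iff)
      then have "ln (ln (M R)) \<le> ln (c + (b + 1) * R powr a)" using elim by simp
      then show ?case using elim by (simp add: divide_right_mono)
    qed
    then have "growth_order f \<le> Limsup at_top (\<lambda>R. ereal (ln (c + (b + 1) * R powr a) / ln R))"
      unfolding growth_order_def M_def using False by (simp add: Limsup_mono)
    moreover have "((\<lambda>R. ln (c + (b + 1) * R powr a) / ln R) \<longlongrightarrow> a) at_top"
      using \<open>a > 0\<close> \<open>b > 0\<close> by real_asymp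
    then have "Limsup at_top (\<lambda>R. ereal (ln (c + (b + 1) * R powr a) / ln R)) = ereal a"
      by (intro lim_imp_Limsup) auto
    ultimately show ?thesis by simp
  qed
  moreover have "growth_type a f \<le> ereal b"
  proof (rule ereal_le_epsilon2)
    fix \<epsilon> :: real assume "\<epsilon> > 0"
    obtain c where c: "\<forall>\<^sub>F R in at_top. ln (M R) \<le> c + (b + \<epsilon>) * R powr a"
      using *[of "b + \<epsilon>"] \<open>\<epsilon> > 0\<close> by auto
    have "\<forall>\<^sub>F R in at_top. ereal (ln (M R) / R powr a) \<le> ereal ((c + (b + \<epsilon>) * R powr a) / R powr a)"
      using c eventually_gt_at_top[of 1]
      by eventually_elim (auto intro!: divide_right_mono)
    then have "growth_type a f \<le> Limsup at_top (\<lambda>R. ereal ((c + (b + \<epsilon>) * R powr a) / R powr a))"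
      unfolding growth_type_def M_def by (rule Limsup_mono)
    moreover have "((\<lambda>R. (c + (b + \<epsilon>) * R powr a) / R powr a) \<longlongrightarrow> b + \<epsilon>) at_top"
      using \<open>a > 0\<close> by real_asymp
    then have "Limsup at_top (\<lambda>R. ereal ((c + (b + \<epsilon>) * R powr a) / R powr a)) = ereal (b + \<epsilon>)"
      by (intro lim_imp_Limsup) auto
    ultimately show "growth_type a f \<le> ereal b + ereal \<epsilon>" by simp
  qed
  ultimately show ?thesis using hol by (auto simp: growth_le_def)
qed

text \<open>Identifies functions of exactly critical growth from membership in the two classes,
  without computing an upper limit.\<close>

lemma growth_le_not_less:
  assumes "f \<in> growth_le a b" "f \<notin> growth_less a b"
  shows "growth_order f = ereal a \<and> growth_type a f = ereal b"
  using assms by (auto simp: growth_le_def growth_less_def)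

section \<open>Radial integrals and rotations in the plane\<close>

text \<open>A disc of radius \<open>sqrt x\<close> has area \<open>pi * x\<close>, so both measures
  agree on the half-lines \<open>{..x}\<close>, which generate the Borel sets and are closed under
  intersection. This takes the place of polar coordinates.\<close>

lemma distr_cmod_power2:
  "distr lborel borel (\<lambda>z::complex. (cmod z)\<^sup>2) = density lborel (\<lambda>x. ennreal pi * indicator {0<..} x)"
    (is "?M = ?N")
proof (rule measure_eqI_generator_eq[where \<Omega> = UNIV and E = "range atMost" and A = "\<lambda>n. {..real n}"])
  show "Int_stable (range (atMost :: real \<Rightarrow> _))"
    by (auto simp: Int_stable_def)
  show "sets ?M = sigma_sets UNIV (range atMost)"
    by (simp add: borel_eq_atMost)
  show "sets ?N = sigma_sets UNIV (range atMost)"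
    by (simp add: borel_eq_atMost[symmetric]) (simp add: borel_eq_atMost)
  have *: "emeasure ?M {..x} = ennreal (pi * max 0 x)" for x
  proof (cases "x \<ge> 0")
    case True
    have "emeasure ?M {..x} = emeasure lborel ((\<lambda>z::complex. (cmod z)\<^sup>2) -` {..x})"
      by (subst emeasure_distr) auto
    also have "(\<lambda>z::complex. (cmod z)\<^sup>2) -` {..x} = cball 0 (sqrt x)"
      using True by (auto simp: real_le_rsqrt sqrt_ge_absD)
    also have "emeasure lborel (cball (0::complex) (sqrt x)) = ennreal (pi * x)"
      using True by (subst emeasure_cball) (auto simp: eval_unit_ball_vol)
    finally show ?thesis using True by simp
  next
    case False
    then have "(\<lambda>z::complex. (cmod z)\<^sup>2) -` {..x} = {}"
      by (auto simp: not_le dest: less_le_trans[of x 0])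
        (smt (verit) zero_le_power2)
    then show ?thesis using False by (subst emeasure_distr) auto
  qed
  show "emeasure ?M {..real n} \<noteq> \<infinity>" for n using * by simp
  show "emeasure ?M X = emeasure ?N X" if X: "X \<in> range atMost" for X
  proof -
    obtain x where x: "X = {..x}" using X by auto
    have "emeasure ?N {..x} = (\<integral>\<^sup>+ y. ennreal pi * indicator {0<..x} y \<partial>lborel)"
      by (subst emeasure_density) (auto intro!: nn_integral_cong simp: indicator_def)
    also have "\<dots> = ennreal pi * emeasure lborel {0<..x}"
      by (subst nn_integral_cmult) auto
    also have "\<dots> = ennreal (pi * max 0 x)"
      by (cases "x \<ge> 0") (auto simp: ennreal_mult)
    finally show ?thesis using * x by simp
  qed
  show "(\<Union>n. {..real n}) = UNIV"
    by (auto intro: real_arch_simple)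
qed auto

lemma nn_integral_radial:
  fixes g :: "real \<Rightarrow> ennreal"
  assumes [measurable]: "g \<in> borel_measurable borel"
  shows "(\<integral>\<^sup>+ z. g ((cmod z)\<^sup>2) \<partial>lborel) = ennreal pi * (\<integral>\<^sup>+ x. g x * indicator {0<..} x \<partial>lborel)"
proof -
  have "(\<integral>\<^sup>+ z. g ((cmod z)\<^sup>2) \<partial>lborel) = (\<integral>\<^sup>+ x. g x \<partial>distr lborel borel (\<lambda>z. (cmod z)\<^sup>2))"
    by (subst nn_integral_distr) auto
  also have "\<dots> = (\<integral>\<^sup>+ x. ennreal pi * (g x * indicator {0<..} x) \<partial>lborel)"
    unfolding distr_cmod_power2
    by (subst nn_integral_density) (auto simp: mult_ac)
  also have "\<dots> = ennreal pi * (\<integral>\<^sup>+ x. g x * indicator {0<..} x \<partial>lborel)"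
    by (subst nn_integral_cmult) auto
  finally show ?thesis .
qed

text \<open>Up to a null set an open set is a disjoint union of balls, whose measure does not
  change under rotation.\<close>

lemma emeasure_open_le_rotate:
  fixes \<omega> :: complex
  assumes U: "open U" and \<omega>: "cmod \<omega> = 1"
  shows "emeasure lborel U \<le> emeasure lborel ((*) \<omega> -` U)"
proof -
  have \<omega>0: "\<omega> \<noteq> 0" using \<omega> by auto
  define K where "K = {(x, r). r > 0 \<and> ball x r \<subseteq> U}"
  obtain C where C: "countable C" "C \<subseteq> K"
     "pairwise (\<lambda>i j. disjnt (ball (fst i) (snd i)) (ball (fst j) (snd j))) C"
     "negligible (U - (\<Union>i\<in>C. ball (fst i) (snd i)))"
  proof (rule Vitali_covering_theorem_balls[of U K fst snd])
    fix x :: complex and d :: real assume "x \<in> U" "d > 0"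
    then obtain r where r: "r > 0" "ball x r \<subseteq> U" using U by (meson open_contains_ball)
    then show "\<exists>i. i \<in> K \<and> x \<in> ball (fst i) (snd i) \<and> snd i < d"
      using \<open>d > 0\<close> by (intro exI[of _ "(x, min r (d/2))"]) (auto simp: K_def)
  qed auto
  define V where "V = (\<Union>i\<in>C. ball (fst i) (snd i))"
  have "V \<subseteq> U" using C(2) by (force simp: V_def K_def)
  moreover have "open V" by (auto simp: V_def)
  ultimately have VU: "V \<subseteq> U" "open V" .
  have "emeasure lborel (U - V) = 0"
    using C(4) U VU by (simp add: negligible_iff_emeasure0 V_def[symmetric])
  then have "emeasure lborel U = emeasure lborel V"
    using emeasure_Un_null_set[of V lborel "U - V"] VU U
    by (simp add: null_sets_def Un_absorb1 Un_Diff_cancel)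
  also have "\<dots> = (\<integral>\<^sup>+ i. emeasure lborel (ball (fst i) (snd i)) \<partial>count_space C)"
    unfolding V_def using C
    by (intro emeasure_UN_countable) (auto simp: disjoint_family_on_def pairwise_def disjnt_def)
  also have "\<dots> = (\<integral>\<^sup>+ i. emeasure lborel (ball (fst i / \<omega>) (snd i)) \<partial>count_space C)"
    using C(2) by (intro nn_integral_cong) (auto simp: emeasure_ball K_def)
  also have "\<dots> = emeasure lborel (\<Union>i\<in>C. ball (fst i / \<omega>) (snd i))"
  proof (rule emeasure_UN_countable[symmetric])
    have eq: "ball (x / \<omega>) r = (*) \<omega> -` ball x r" for x r
    proof -
      have "x / \<omega> - y = (x - \<omega> * y) / \<omega>" for y using \<omega>0 by (simp add: field_simps)
      then show ?thesis using \<omega> by (auto simp: dist_norm norm_divide)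
    qed
    show "disjoint_family_on (\<lambda>i. ball (fst i / \<omega>) (snd i)) C"
      unfolding eq using C(3) by (fastforce simp: disjoint_family_on_def pairwise_def disjnt_def)
  qed (use C in auto)
  also have "\<dots> \<le> emeasure lborel ((*) \<omega> -` U)"
  proof (rule emeasure_mono)
    show "(\<Union>i\<in>C. ball (fst i / \<omega>) (snd i)) \<subseteq> (*) \<omega> -` U"
    proof safe
      fix x r y assume i: "(x, r) \<in> C" "y \<in> ball (fst (x, r) / \<omega>) (snd (x, r))"
      have "x - \<omega> * y = (x / \<omega> - y) * \<omega>" using \<omega>0 by (simp add: field_simps)
      then have "\<omega> * y \<in> ball x r" using i \<omega> by (simp add: dist_norm norm_mult)
      then show "y \<in> (*) \<omega> -` U" using i(1) C(2) by (force simp: K_def)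
    qed
    show "(*) \<omega> -` U \<in> sets lborel"
      using U by (simp add: continuous_intros open_vimage)
  qed
  finally show ?thesis .
qed

text \<open>The preceding inequality, applied to \<open>1/\<omega>\<close> and the rotated set, also
  gives the reverse inequality. Open sets then determine the measure.\<close>

lemma distr_lborel_rotate:
  fixes \<omega> :: complex
  assumes \<omega>: "cmod \<omega> = 1"
  shows "distr lborel borel ((*) \<omega>) = lborel"
proof (rule measure_eqI_generator_eq[where \<Omega> = UNIV and E = "{S. open S}" and A = "\<lambda>n. ball 0 (real n)"])
  have open_rot: "open ((*) w -` S)" if "open S" for w and S :: "complex set"
    using that by (intro open_vimage) (auto intro!: continuous_intros)
  have *: "emeasure (distr lborel borel ((*) \<omega>)) S = emeasure lborel S" if S: "open S" for S
  proof -
    have "(*) (1/\<omega>) -` (*) \<omega> -` S = S" using \<omega> by (auto simp: vimage_def)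
    then have "emeasure lborel ((*) \<omega> -` S) \<le> emeasure lborel S"
      using emeasure_open_le_rotate[OF open_rot[OF S, of \<omega>], of "1/\<omega>"] \<omega> by (simp add: norm_divide)
    then show ?thesis using emeasure_open_le_rotate[OF S \<omega>] S
      by (subst emeasure_distr) auto
  qed
  then show "emeasure (distr lborel borel ((*) \<omega>)) S = emeasure lborel S" if "S \<in> {S. open S}" for S
    using that by auto
  show "emeasure (distr lborel borel ((*) \<omega>)) (ball 0 (real n)) \<noteq> \<infinity>" for n
    by (simp add: * emeasure_ball)
  show "(\<Union>n. ball (0::complex) (real n)) = UNIV"
    by (auto intro: reals_Archimedean2)
qed (auto simp: Int_stable_def borel_def)

lemma nn_integral_rotate:
  fixes f :: "complex \<Rightarrow> ennreal"
  assumes [measurable]: "f \<in> borel_measurable borel" and \<omega>: "cmod \<omega> = 1"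
  shows "(\<integral>\<^sup>+ z. f (\<omega> * z) \<partial>lborel) = (\<integral>\<^sup>+ z. f z \<partial>lborel)"
proof -
  have "(\<integral>\<^sup>+ z. f z \<partial>lborel) = (\<integral>\<^sup>+ z. f z \<partial>distr lborel borel ((*) \<omega>))"
    by (simp add: distr_lborel_rotate[OF \<omega>])
  also have "\<dots> = (\<integral>\<^sup>+ z. f (\<omega> * z) \<partial>lborel)" by (subst nn_integral_distr) auto
  finally show ?thesis by simp
qed

section \<open>Log-asymptotic weights and their moments\<close>

text \<open>Collects the data on the weight alone, so that the Bargmann space can be treated without
  reference to a Hilbert space.\<close>

locale log_asymptotic_weight =
  fixes \<rho> :: "nat \<Rightarrow> real" and W :: "real \<Rightarrow> real" and a b :: real
  assumes \<rho>_pos: "\<rho> n > 0"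
    and W_pos: "x > 0 \<Longrightarrow> W x > 0"
    and W_integrable: "set_integrable lebesgue {0<..} (\<lambda>x. x ^ n * W x)"
    and W_moment: "(LINT x:{0<..}|lebesgue. x ^ n * W x) = \<rho> n"
    and a_pos: "a > 0" and b_pos: "b > 0"
    and W_asymp: "((\<lambda>z::complex. ln (W ((cmod z)\<^sup>2)) / (- 2 * b * cmod z powr a)) \<longlongrightarrow> 1) at_infinity"
begin

text \<open>The quotient in \<open>W_asymp\<close> tends to 1, so it finally lies between
  \<open>s1 / b\<close> and \<open>s2 / b\<close>; multiplying by the negative denominator reverses
  the inequalities. The substitution \<open>x = r\<^sup>2\<close> halves the exponent
  \<open>a\<close>.\<close>

lemma W_bounds:
  assumes "s1 < b" "b < s2"
  obtains x0 where "x0 > 0"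
    "\<And>x. x \<ge> x0 \<Longrightarrow> W x \<le> exp (- 2 * s1 * x powr (a/2))"
    "\<And>x. x \<ge> x0 \<Longrightarrow> W x \<ge> exp (- 2 * s2 * x powr (a/2))"
proof -
  have lim: "((\<lambda>r. ln (W (r\<^sup>2)) / (- 2 * b * r powr a)) \<longlongrightarrow> 1) at_top"
  proof -
    have "filterlim complex_of_real at_infinity at_top"
      by (rule filterlim_of_real_at_infinity)
    from filterlim_compose[OF W_asymp this]
    have "((\<lambda>r. ln (W (\<bar>r\<bar>\<^sup>2)) / (- 2 * b * \<bar>r\<bar> powr a)) \<longlongrightarrow> 1) at_top"
      by simp
    then show ?thesis
      by (rule Lim_transform_eventually) (use eventually_ge_at_top[of 0] in eventually_elim, simp)
  qed
  have "\<forall>\<^sub>F r in at_top. s1 / b < ln (W (r\<^sup>2)) / (- 2 * b * r powr a) \<and>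
          ln (W (r\<^sup>2)) / (- 2 * b * r powr a) < s2 / b"
    using assms b_pos by (intro eventually_conj order_tendstoD[OF lim]) auto
  then have "\<forall>\<^sub>F r in at_top. r > 0 \<and> W (r\<^sup>2) \<le> exp (- 2 * s1 * r powr a) \<and>
      W (r\<^sup>2) \<ge> exp (- 2 * s2 * r powr a)"
    using eventually_gt_at_top[of 0]
  proof eventually_elim
    case (elim r)
    define P where "P = r powr a"
    have P: "P > 0" using elim by (simp add: P_def)
    have "ln (W (r\<^sup>2)) \<le> - 2 * s1 * P" "ln (W (r\<^sup>2)) \<ge> - 2 * s2 * P"
      using elim P b_pos unfolding P_def[symmetric] by (simp_all add: field_simps)
    moreover have "W (r\<^sup>2) > 0" using W_pos elim by simp
    ultimately show ?case using elim unfolding P_def[symmetric]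
      by (metis exp_le_cancel_iff exp_ln)
  qed
  then obtain R where R: "\<And>r. r \<ge> R \<Longrightarrow> r > 0 \<and> W (r\<^sup>2) \<le> exp (- 2 * s1 * r powr a) \<and>
      W (r\<^sup>2) \<ge> exp (- 2 * s2 * r powr a)"
    by (auto simp: eventually_at_top_linorder)
  have Rp: "R > 0" using R[of R] by auto
  show ?thesis
  proof (rule that[of "R\<^sup>2"])
    fix x assume "x \<ge> R\<^sup>2"
    moreover from this Rp have "x > 0" by (smt (verit) zero_less_power)
    moreover from calculation have "sqrt x \<ge> R" by (simp add: real_le_rsqrt)
    moreover have "(sqrt x) powr a = x powr (a/2)"
      using \<open>x > 0\<close> by (simp add: powr_half_sqrt[symmetric] powr_powr)
    ultimately show "W x \<le> exp (- 2 * s1 * x powr (a/2))" "W x \<ge> exp (- 2 * s2 * x powr (a/2))"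
      using R[of "sqrt x"] by auto
  qed (use Rp in auto)
qed

text \<open>\<^term>\<open>W\<close> is only Lebesgue measurable; a Borel representative makes its composition with
  \<open>z \<mapsto> |z|\<^sup>2\<close> measurable.\<close>

definition W' :: "real \<Rightarrow> real" where
  "W' = (SOME w. w \<in> borel_measurable borel \<and> (\<forall>x. w x \<ge> 0) \<and>
           (AE x in lborel. x > 0 \<longrightarrow> w x = W x))"

lemma W': "W' \<in> borel_measurable borel" "W' x \<ge> 0" "AE x in lborel. x > 0 \<longrightarrow> W' x = W x"
proof -
  \<comment> \<open>The moment of index 0 supplies the measurability of \<open>W\<close> on the
    positive half-line.\<close>
  have "(\<lambda>x. indicator {0<..} x *\<^sub>R (x ^ 0 * W x)) \<in> borel_measurable lebesgue"
    using W_integrable[of 0] unfolding set_integrable_def by (rule borel_measurable_integrable)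
  then obtain w where w: "w \<in> borel_measurable lborel" "AE x in lborel. indicator {0<..} x *\<^sub>R (x ^ 0 * W x) = w x"
    using completion_ex_borel_measurable_real by blast
  have ae: "AE x in lborel. x > 0 \<longrightarrow> max 0 (w x) = W x"
    using w(2)
  proof eventually_elim
    case (elim x)
    then show ?case using W_pos[of x] by (auto simp: indicator_def)
  qed
  have "(\<lambda>x. max 0 (w x)) \<in> borel_measurable borel \<and> (\<forall>x. max 0 (w x) \<ge> 0) \<and>
           (AE x in lborel. x > 0 \<longrightarrow> max 0 (w x) = W x)"
    using ae w(1) by (intro conjI borel_measurable_max) auto
  then have "\<exists>w. w \<in> borel_measurable borel \<and> (\<forall>x. w x \<ge> 0) \<and>
           (AE x in lborel. x > 0 \<longrightarrow> w x = W x)" by blast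
  from someI_ex[OF this]
  show "W' \<in> borel_measurable borel" "W' x \<ge> 0" "AE x in lborel. x > 0 \<longrightarrow> W' x = W x"
    unfolding W'_def by blast+
qed

lemmas [measurable] = W'(1)

lemma nn_integral_moment:
  "(\<integral>\<^sup>+ x. ennreal (W' x * x ^ n) * indicator {0<..} x \<partial>lborel) = ennreal (\<rho> n)"
proof -
  have "(\<integral>\<^sup>+ x. ennreal (W' x * x ^ n) * indicator {0<..} x \<partial>lborel)
      = (\<integral>\<^sup>+ x. ennreal (W' x * x ^ n) * indicator {0<..} x \<partial>lebesgue)"
    by (simp add: nn_integral_completion)
  also have "\<dots> = (\<integral>\<^sup>+ x. ennreal (indicator {0<..} x *\<^sub>R (x ^ n * W x)) \<partial>lebesgue)"
    using AE_completion[OF W'(3)]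
    by (intro nn_integral_cong_AE) (auto elim!: eventually_mono simp: indicator_def mult_ac)
  also have "\<dots> = ennreal (\<rho> n)"
  proof (subst nn_integral_eq_integral)
    show "integrable lebesgue (\<lambda>x. indicator {0<..} x *\<^sub>R (x ^ n * W x))"
      using W_integrable[of n] by (simp add: set_integrable_def)
    show "AE x in lebesgue. 0 \<le> indicat_real {0<..} x *\<^sub>R (x ^ n * W x)"
      using W_pos by (auto simp: indicator_def intro!: AE_I2 less_imp_le)
  qed (use W_moment[of n] in \<open>simp add: set_lebesgue_integral_def\<close>)
  finally show ?thesis .
qed

text \<open>The exceptional set on the half-line lies in a Borel null set \<open>N\<close>. By the
  radial integral formula for the indicator of \<open>N\<close>, its preimage under
  \<open>z \<mapsto> |z|\<^sup>2\<close> meets the punctured plane in a null set; the origin is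
  removed separately.\<close>

lemma AE_W'_plane: "AE z::complex in lborel. W' ((cmod z)\<^sup>2) = W ((cmod z)\<^sup>2)"
proof -
  obtain N where N: "{x. \<not> (x > 0 \<longrightarrow> W' x = W x)} \<subseteq> N" "N \<in> null_sets lborel"
    using W'(3) by (auto elim!: AE_E3 simp: eventually_ae_filter)
  have [measurable]: "N \<in> sets borel" using N by auto
  have "(\<integral>\<^sup>+ z. indicator N ((cmod z)\<^sup>2) \<partial>(lborel :: complex measure)) = 0"
  proof (subst nn_integral_radial)
    have "AE x in lborel. x \<notin> N" using N(2) by (rule AE_not_in)
    then have "(\<integral>\<^sup>+ x. indicator N x * indicator {0<..} x \<partial>lborel) = (\<integral>\<^sup>+ x. 0 \<partial>(lborel::real measure))"
      by (intro nn_integral_cong_AE) (auto elim!: eventually_mono)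
    then show "ennreal pi * (\<integral>\<^sup>+ x. indicator N x * indicator {0<..} x \<partial>lborel) = 0" by simp
  qed auto
  then have "AE z::complex in lborel. indicator N ((cmod z)\<^sup>2) = (0::ennreal)"
    by (subst (asm) nn_integral_0_iff_AE) auto
  moreover have "AE z::complex in lborel. z \<noteq> 0"
    by (rule AE_lborel_singleton)
  ultimately show ?thesis
  proof eventually_elim
    case (elim z)
    then have "(cmod z)\<^sup>2 \<notin> N" "(cmod z)\<^sup>2 > 0" by (auto simp: indicator_def split: if_splits)
    then show ?case using N(1) by blast
  qed
qed

text \<open>The squared norm \<open>(f, f)\<close>, taken as a nonnegative integral so that infinite
  values are allowed, and with the Borel representative of the weight.\<close>

definition sqnorm :: "(complex \<Rightarrow> complex) \<Rightarrow> ennreal" where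
  "sqnorm f = (\<integral>\<^sup>+ z. ennreal (W' ((cmod z)\<^sup>2) / pi * (cmod (f z))\<^sup>2) \<partial>lborel)"

lemma holomorphic_borel_measurable:
  "f holomorphic_on UNIV \<Longrightarrow> f \<in> borel_measurable borel"
  by (intro borel_measurable_continuous_onI holomorphic_on_imp_continuous_on)

text \<open>The integrand of \<open>(f, f)\<close> is almost everywhere the nonnegative Borel
  function \<open>g\<close>, so Lebesgue integrability becomes finiteness of one nonnegative
  integral.\<close>

lemma bargmann_space_iff:
  "f \<in> bargmann_space W \<longleftrightarrow> f holomorphic_on UNIV \<and> sqnorm f < \<infinity>"
proof (cases "f holomorphic_on UNIV")
  case True
  then have [measurable]: "f \<in> borel_measurable borel" by (rule holomorphic_borel_measurable)
  define g where "g = (\<lambda>z. W' ((cmod z)\<^sup>2) / pi * (cmod (f z))\<^sup>2)"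
  have [measurable]: "g \<in> borel_measurable borel" unfolding g_def by measurable
  have m: "(\<lambda>z. complex_of_real (g z)) \<in> borel_measurable lebesgue"
    by (intro measurable_completion) measurable
  have ae: "AE z in lebesgue. complex_of_real (g z) = bargmann_integrand W f f z"
    using AE_completion[OF AE_W'_plane]
    by eventually_elim (simp add: g_def bargmann_integrand_def complex_norm_square[symmetric] mult_ac
        flip: of_real_power)
  have "integrable lebesgue (bargmann_integrand W f f) \<longleftrightarrow>
      integrable lebesgue (\<lambda>z. complex_of_real (g z))"
    using borel_measurable_AE[OF m ae] m ae
    by (intro integrable_cong_AE) (auto elim!: eventually_mono)
  also have "\<dots> \<longleftrightarrow> integrable lborel g"
    by (simp add: integrable_completion complex_of_real_integrable_eq)
  also have "\<dots> \<longleftrightarrow> sqnorm f < \<infinity>"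
    unfolding integrable_iff_bounded sqnorm_def g_def using W'(2) by (auto simp: abs_mult)
  finally show ?thesis using True by (simp add: bargmann_space_def)
qed (simp add: bargmann_space_def)

text \<open>The factor \<open>pi\<close> from the area cancels the \<open>1 / pi\<close> of the
  scalar product.\<close>

lemma sqnorm_radial:
  assumes [measurable]: "g \<in> borel_measurable borel" and g: "\<And>x. x > 0 \<Longrightarrow> g x \<ge> 0"
  shows "(\<integral>\<^sup>+ z. ennreal (W' ((cmod z)\<^sup>2) / pi * g ((cmod z)\<^sup>2)) \<partial>lborel) =
     (\<integral>\<^sup>+ x. ennreal (W' x * g x) * indicator {0<..} x \<partial>lborel)"
proof -
  have "(\<integral>\<^sup>+ z. ennreal (W' ((cmod z)\<^sup>2) / pi * g ((cmod z)\<^sup>2)) \<partial>lborel)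
     = ennreal pi * (\<integral>\<^sup>+ x. ennreal (W' x / pi * g x) * indicator {0<..} x \<partial>lborel)"
    by (rule nn_integral_radial[of "\<lambda>x. ennreal (W' x / pi * g x)"]) measurable
  also have "\<dots> = (\<integral>\<^sup>+ x. ennreal pi * (ennreal (W' x / pi * g x) * indicator {0<..} x) \<partial>lborel)"
    by (subst nn_integral_cmult) auto
  also have "\<dots> = (\<integral>\<^sup>+ x. ennreal (W' x * g x) * indicator {0<..} x \<partial>lborel)"
    using W'(2) g by (intro nn_integral_cong) (auto simp: indicator_def ennreal_mult'[symmetric])
  finally show ?thesis .
qed

text \<open>With \<open>s < s1 < b\<close>, beyond some \<open>X\<close> the weight is at most
  \<open>exp (- 2 * s1 * x powr (a/2))\<close>, so the integrand decays like a stretched exponential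
  and stays below \<open>1 / x^2\<close>. Up to \<open>X\<close> the exponential is bounded by
  \<open>K\<close> and the zeroth moment is finite.\<close>

lemma nn_integral_exp_W'_finite:
  assumes "s < b"
  shows "(\<integral>\<^sup>+ x. ennreal (W' x * exp (2 * s * x powr (a/2))) * indicator {0<..} x \<partial>lborel) < \<infinity>"
proof -
  define s1 where "s1 = (s + b) / 2"
  have s1: "s < s1" "s1 < b" using assms by (auto simp: s1_def)
  obtain x0 where x0: "x0 > 0" "\<And>x. x \<ge> x0 \<Longrightarrow> W x \<le> exp (- 2 * s1 * x powr (a/2))"
      "\<And>x. x \<ge> x0 \<Longrightarrow> W x \<ge> exp (- 2 * (b + 1) * x powr (a/2))"
    by (rule W_bounds[of s1 "b+1"]) (use s1 in auto)
  have "\<forall>\<^sub>F x::real in at_top. exp (- (2 * (s1 - s) * x powr (a/2))) \<le> 1 / x^2"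
  proof -
    have "((\<lambda>x::real. exp (- (2 * (s1 - s) * x powr (a/2))) * x^2) \<longlongrightarrow> 0) at_top"
      using s1 a_pos by real_asymp
    then have "\<forall>\<^sub>F x in at_top. exp (- (2 * (s1 - s) * x powr (a/2))) * x^2 < 1"
      by (rule order_tendstoD) auto
    then show ?thesis using eventually_gt_at_top[of 0]
      by eventually_elim (simp add: field_simps)
  qed
  then obtain x1 where x1: "\<And>x::real. x \<ge> x1 \<Longrightarrow> exp (- (2 * (s1 - s) * x powr (a/2))) \<le> 1 / x^2"
    by (auto simp: eventually_at_top_linorder)
  define X where "X = max x0 x1"
  have X: "X > 0" "X \<ge> x0" "X \<ge> x1" using x0 by (auto simp: X_def)
  define K where "K = exp (2 * \<bar>s\<bar> * X powr (a/2))"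
  \<comment> \<open>The factor \<open>x^0\<close> gives the first summand the form of
    \<open>nn_integral_moment\<close> with index 0.\<close>
  have "(\<integral>\<^sup>+ x. ennreal (W' x * exp (2 * s * x powr (a/2))) * indicator {0<..} x \<partial>lborel)
     \<le> (\<integral>\<^sup>+ x. ennreal K * (ennreal (W' x * x^0) * indicator {0<..} x) + ennreal (1 / x^2) * indicator {X..} x \<partial>lborel)"
  proof (rule nn_integral_mono_AE)
    show "AE x in lborel. ennreal (W' x * exp (2 * s * x powr (a/2))) * indicator {0<..} x
       \<le> ennreal K * (ennreal (W' x * x^0) * indicator {0<..} x) + ennreal (1 / x^2) * indicator {X..} x"
      using W'(3)
    proof eventually_elim
      case (elim x)
      consider "x \<le> 0" | "x > 0" "x < X" | "x \<ge> X" by linarith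
      then show ?case
      proof cases
        case 2
        have "2 * s * x powr (a/2) \<le> 2 * \<bar>s\<bar> * X powr (a/2)"
        proof -
          have "s * x powr (a/2) \<le> \<bar>s\<bar> * x powr (a/2)" by (intro mult_right_mono) auto
          also have "\<dots> \<le> \<bar>s\<bar> * X powr (a/2)"
            using 2 a_pos by (intro mult_left_mono powr_mono2) auto
          finally show ?thesis by simp
        qed
        then have "W' x * exp (2 * s * x powr (a/2)) \<le> K * W' x"
          using W'(2)[of x] by (subst mult.commute) (auto intro!: mult_right_mono simp: K_def)
        then show ?thesis using 2 W'(2)[of x]
          by (auto simp: ennreal_mult'[symmetric] K_def intro!: ennreal_leI)
      next
        case 3
        have "x > 0" using 3 X by linarith
        have "W' x * exp (2 * s * x powr (a/2)) \<le>
            exp (- 2 * s1 * x powr (a/2)) * exp (2 * s * x powr (a/2))"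
          using elim 3 X x0(2)[of x] \<open>x > 0\<close> by (intro mult_right_mono) auto
        also have "\<dots> = exp (- (2 * (s1 - s) * x powr (a/2)))"
          by (simp add: exp_add[symmetric] algebra_simps)
        also have "\<dots> \<le> 1 / x^2" using x1[of x] 3 X by auto
        finally have "ennreal (W' x * exp (2 * s * x powr (a/2))) \<le> ennreal (1 / x^2)"
          by (rule ennreal_leI)
        then show ?thesis using 3 \<open>x > 0\<close> by (auto intro: add_increasing)
      qed auto
    qed
  qed
  also have "\<dots> = ennreal K * (\<integral>\<^sup>+ x. ennreal (W' x * x^0) * indicator {0<..} x \<partial>lborel)
      + (\<integral>\<^sup>+ x. ennreal (1 / x^2) * indicator {X..} x \<partial>lborel)"
    by (subst nn_integral_add) (auto simp: nn_integral_cmult)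
  also have "(\<integral>\<^sup>+ x. ennreal (1 / x^2) * indicator {X..} x \<partial>lborel) = ennreal (0 - (- 1 / X))"
  proof (rule nn_integral_FTC_atLeast)
    show "((\<lambda>x. - 1 / x) has_real_derivative 1 / x^2) (at x)" if "X \<le> x" for x
      using that X by (auto intro!: derivative_eq_intros simp: field_simps power2_eq_square)
    show "((\<lambda>x::real. - 1 / x) \<longlongrightarrow> 0) at_top" by real_asymp
  qed (use X in auto)
  also have "ennreal K * (\<integral>\<^sup>+ x. ennreal (W' x * x^0) * indicator {0<..} x \<partial>lborel)
      + ennreal (0 - (- 1 / X)) < \<infinity>"
    unfolding nn_integral_moment by (simp add: ennreal_mult_less_top)
  finally show ?thesis .
qed

text \<open>Squaring doubles the exponent, which matches the factor 2 in the decay rate of the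
  weight; the radial formula then reduces the claim to
  \<open>nn_integral_exp_W'_finite\<close>.\<close>

lemma exp_bounded_imp_bargmann:
  assumes hol: "f holomorphic_on UNIV" and "s < b" "exp_bounded s a f"
  shows "f \<in> bargmann_space W"
proof -
  obtain C where C: "\<And>z. cmod (f z) \<le> C * exp (s * cmod z powr a)"
    using assms(3) by (auto simp: exp_bounded_def)
  have "sqnorm f \<le> (\<integral>\<^sup>+ z. ennreal (W' ((cmod z)\<^sup>2) / pi * (C\<^sup>2 * exp (2 * s * ((cmod z)\<^sup>2) powr (a/2)))) \<partial>lborel)"
    unfolding sqnorm_def
  proof (intro nn_integral_mono ennreal_leI mult_left_mono)
    fix z :: complex
    have "(cmod (f z))\<^sup>2 \<le> (C * exp (s * cmod z powr a))\<^sup>2"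
      using C by (intro power_mono) auto
    also have "cmod z powr a = ((cmod z)\<^sup>2) powr (a/2)"
      by (cases "z = 0") (simp_all add: powr_powr flip: powr_numeral)
    finally show "(cmod (f z))\<^sup>2 \<le> C\<^sup>2 * exp (2 * s * ((cmod z)\<^sup>2) powr (a/2))"
      by (simp add: power_mult_distrib mult.assoc flip: exp_double)
  qed (use W'(2) in auto)
  also have "\<dots> = (\<integral>\<^sup>+ x. ennreal (W' x * (C\<^sup>2 * exp (2 * s * x powr (a/2)))) * indicator {0<..} x \<partial>lborel)"
    by (rule sqnorm_radial) auto
  also have "\<dots> = (\<integral>\<^sup>+ x. ennreal (C\<^sup>2) * (ennreal (W' x * exp (2 * s * x powr (a/2))) * indicator {0<..} x) \<partial>lborel)"
    using W'(2) by (intro nn_integral_cong) (auto simp: indicator_def ennreal_mult'[symmetric] mult_ac)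
  also have "\<dots> = ennreal (C\<^sup>2) * (\<integral>\<^sup>+ x. ennreal (W' x * exp (2 * s * x powr (a/2))) * indicator {0<..} x \<partial>lborel)"
    by (subst nn_integral_cmult) auto
  also have "\<dots> < \<infinity>"
    using nn_integral_exp_W'_finite[OF \<open>s < b\<close>] by (simp add: ennreal_mult_less_top)
  finally show ?thesis using hol by (simp add: bargmann_space_iff)
qed

text \<open>The moment is at least its part over \<open>[x, x + 1]\<close> with
  \<open>x = r\<^sup>2\<close>, where the weight is bounded below and
  \<open>y ^ n \<ge> x ^ n\<close>; a square root gives the claim. The essential point is that one
  constant serves all \<open>n\<close>.\<close>

lemma power_le_exp_sqrt_moment:
  assumes "s > b"
  obtains C where "C > 0" "\<And>n r. r \<ge> 0 \<Longrightarrow> r ^ n \<le> C * exp (s * r powr a) * sqrt (\<rho> n)"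
proof -
  define s2 where "s2 = (s + b) / 2"
  have s2: "s2 < s" "b < s2" "s2 > 0" using assms b_pos by (auto simp: s2_def)
  obtain x0 where x0: "x0 > 0" "\<And>x. x \<ge> x0 \<Longrightarrow> W x \<le> exp (- 2 * (b - 1) * x powr (a/2))"
      "\<And>x. x \<ge> x0 \<Longrightarrow> W x \<ge> exp (- 2 * s2 * x powr (a/2))"
    by (rule W_bounds[of "b-1" s2]) (use s2 in auto)
  have *: "exp (- 2 * s2 * (x + 1) powr (a/2)) * x ^ n \<le> \<rho> n" if "x \<ge> x0" for x n
  proof -
    have xp: "x > 0" using that x0 by linarith
    have "ennreal (exp (- 2 * s2 * (x + 1) powr (a/2)) * x ^ n) =
        (\<integral>\<^sup>+ y. ennreal (exp (- 2 * s2 * (x + 1) powr (a/2)) * x ^ n) * indicator {x..x+1} y \<partial>lborel)"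
      by (simp add: nn_integral_cmult)
    also have "\<dots> \<le> (\<integral>\<^sup>+ y. ennreal (W' y * y ^ n) * indicator {0<..} y \<partial>lborel)"
    proof (rule nn_integral_mono_AE)
      show "AE y in lborel. ennreal (exp (- 2 * s2 * (x + 1) powr (a/2)) * x ^ n) * indicator {x..x+1} y
          \<le> ennreal (W' y * y ^ n) * indicator {0<..} y"
        using W'(3)
      proof eventually_elim
        case (elim y)
        show ?case
        proof (cases "y \<in> {x..x+1}")
          case True
          then have y: "y > 0" "y \<ge> x0" "x \<le> y" "y \<le> x + 1" using xp that by auto
          have "exp (- 2 * s2 * (x + 1) powr (a/2)) \<le> exp (- 2 * s2 * y powr (a/2))"
            using y s2 a_pos by (auto intro!: powr_mono2)
          also have "\<dots> \<le> W' y" using elim x0(3) y by auto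
          finally have "exp (- 2 * s2 * (x + 1) powr (a/2)) * x ^ n \<le> W' y * y ^ n"
            using y xp W'(2)[of y] by (intro mult_mono power_mono) auto
          then show ?thesis using True y by (auto intro!: ennreal_leI)
        qed auto
      qed
    qed
    also have "\<dots> = ennreal (\<rho> n)" by (rule nn_integral_moment)
    finally show ?thesis using \<rho>_pos[of n] by (subst (asm) ennreal_le_iff) auto
  qed
  \<comment> \<open>Replacing \<open>r\<^sup>2\<close> by \<open>r\<^sup>2 + 1\<close> does not
    change the leading term, so the gap between \<open>s2\<close> and \<open>s\<close> absorbs
    it.\<close>
  have "\<forall>\<^sub>F r::real in at_top. r \<ge> sqrt x0 \<and> s2 * (r\<^sup>2 + 1) powr (a/2) \<le> s * r powr a"
  proof -
    have "((\<lambda>r::real. (s2 * (r\<^sup>2 + 1) powr (a/2)) / (r powr a)) \<longlongrightarrow> s2) at_top"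
      using a_pos s2 by real_asymp
    then have "\<forall>\<^sub>F r in at_top. (s2 * (r\<^sup>2 + 1) powr (a/2)) / (r powr a) < s"
      using s2(1) by (rule order_tendstoD)
    then show ?thesis using eventually_gt_at_top[of 0] eventually_ge_at_top[of "sqrt x0"]
      by eventually_elim (simp add: field_simps)
  qed
  then obtain R0 where R0: "\<And>r. r \<ge> R0 \<Longrightarrow> r \<ge> sqrt x0 \<and> s2 * (r\<^sup>2 + 1) powr (a/2) \<le> s * r powr a"
    by (auto simp: eventually_at_top_linorder)
  have R0p: "R0 > 0" using R0[of R0] x0 by (meson order_refl less_le_trans real_sqrt_gt_zero)
  have large: "r ^ n \<le> exp (s * r powr a) * sqrt (\<rho> n)" if "r \<ge> R0" for r n
  proof -
    have r: "r > 0" "r\<^sup>2 \<ge> x0"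
      using R0[OF that] R0p that sqrt_le_D by (linarith, blast)
    have "(r ^ n)\<^sup>2 \<le> exp (2 * (s2 * (r\<^sup>2 + 1) powr (a/2))) * \<rho> n"
      using *[OF r(2), of n] by (simp add: exp_minus field_simps flip: power_mult)
    also have "\<dots> \<le> exp (2 * (s * r powr a)) * \<rho> n"
      using R0[OF that] \<rho>_pos[of n] by (intro mult_right_mono) auto
    finally have "(r ^ n)\<^sup>2 \<le> (exp (s * r powr a) * sqrt (\<rho> n))\<^sup>2"
      using \<rho>_pos[of n] by (simp add: power_mult_distrib exp_double)
    then show ?thesis by (rule power2_le_imp_le) (use \<rho>_pos[of n] in auto)
  qed
  \<comment> \<open>For \<open>r < R0\<close> the power is at most \<open>R0 ^ n\<close>, and the
    estimate at \<open>R0\<close> has exactly this exponential factor.\<close>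
  define C where "C = exp (s * R0 powr a)"
  have C1: "C \<ge> 1" using assms b_pos by (simp add: C_def)
  show ?thesis
  proof (rule that[of C])
    fix r :: real and n assume r: "r \<ge> 0"
    have sp: "s > 0" using assms b_pos by linarith
    show "r ^ n \<le> C * exp (s * r powr a) * sqrt (\<rho> n)"
    proof (cases "r \<ge> R0")
      case True
      have "1 * (exp (s * r powr a) * sqrt (\<rho> n)) \<le> C * (exp (s * r powr a) * sqrt (\<rho> n))"
        using C1 \<rho>_pos[of n] by (intro mult_right_mono) auto
      with large[OF True, of n] show ?thesis by (simp only: mult.assoc mult_1)
    next
      case False
      then have "r ^ n \<le> R0 ^ n" using r by (intro power_mono) auto
      also have "\<dots> \<le> C * 1 * sqrt (\<rho> n)" using large[of R0 n] by (simp add: C_def)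
      also have "\<dots> \<le> C * exp (s * r powr a) * sqrt (\<rho> n)"
      proof (intro mult_right_mono mult_left_mono)
        show "1 \<le> exp (s * r powr a)" using sp by simp
      qed (use C1 \<rho>_pos[of n] in \<open>auto intro: less_imp_le\<close>)
      finally show ?thesis .
    qed
  qed (use C1 in auto)
qed

end

section \<open>Coefficients of entire functions\<close>

lemma entire_power_series_holomorphic:
  assumes "\<And>z. (\<lambda>n. c n * z ^ n) sums f z"
  shows "f holomorphic_on UNIV"
proof -
  have "f holomorphic_on (\<Union>n::nat. ball 0 (real n))"
    by (intro holomorphic_on_UN_open power_series_holomorphic[of 0 _ c]) (use assms in auto)
  also have "(\<Union>n::nat. ball (0::complex) (real n)) = UNIV"
    by (auto intro: reals_Archimedean2)
  finally show ?thesis .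
qed

lemma entire_power_series:
  assumes "f holomorphic_on UNIV"
  obtains c where "\<And>z. (\<lambda>n. c n * z ^ n) sums f z"
proof
  fix z :: complex
  show "(\<lambda>n. ((deriv ^^ n) f 0 / fact n) * z ^ n) sums f z"
    using holomorphic_power_series[of f 0 "cmod z + 1" z] assms holomorphic_on_subset by auto
qed

text \<open>A discrete form of the mean of \<open>f (w * z) * cnj w ^ n\<close> over the unit
  circle, which extracts the monomial of degree \<open>n\<close>. Being a finite sum of rotated
  copies of \<open>f\<close>, it needs only the invariance of planar measure under single
  rotations.\<close>

definition unity_average :: "(complex \<Rightarrow> complex) \<Rightarrow> nat \<Rightarrow> nat \<Rightarrow> complex \<Rightarrow> complex" where
  "unity_average f n m z =
     (\<Sum>k<m. f (cis (2 * pi / m) ^ k * z) * cnj (cis (2 * pi / m)) ^ (k * n)) / of_nat m"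

text \<open>Averaging over the \<open>m\<close>-th roots of unity kills all coefficients of index
  \<open>j < m\<close> other than \<open>n\<close>, and does not enlarge the remaining ones.\<close>

lemma unity_average_tendsto:
  assumes f: "\<And>z. (\<lambda>n. c n * z ^ n) sums f z"
  shows "(\<lambda>m. unity_average f n m z) \<longlonglongrightarrow> c n * z ^ n"
proof -
  have abs: "summable (\<lambda>j. norm (c j * z ^ j))" for z
  proof -
    \<comment> \<open>Convergence at a point farther from the origin yields absolute convergence at
      \<open>z\<close>.\<close>
    define w where "w = complex_of_real (cmod z + 1)"
    have "cmod z < cmod w" unfolding w_def norm_of_real by simp
    moreover have "summable (\<lambda>j. c j * w ^ j)" using f sums_summable by blast
    ultimately show ?thesis by (rule powser_insidea[rotated])
  qed
  define T where "T = (\<lambda>m. (\<Sum>j. norm (c (j + m) * z ^ (j + m))))"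
  have T: "T \<longlonglongrightarrow> 0"
    unfolding T_def using suminf_exist_split2[OF abs[of z]] by blast
  have "norm (unity_average f n m z - c n * z ^ n) \<le> T m" if m: "m > n" for m
  proof -
    define \<omega> where "\<omega> = cis (2 * pi / m)"
    \<comment> \<open>The multiplier that averaging puts on the coefficient of index
      \<open>j\<close>: it is 1 for \<open>j = n\<close>, 0 for other \<open>j < m\<close>, and of
      modulus at most 1 always. So the error is at most the tail \<open>T m\<close>.\<close>
    define q where "q = (\<lambda>j. (\<Sum>k<m. (\<omega> ^ j * cnj \<omega> ^ n) ^ k) / of_nat m)"
    have m0: "m > 0" using m by simp
    have [simp]: "cmod \<omega> = 1" by (simp add: \<omega>_def)
    have inv: "\<omega> * cnj \<omega> = 1" by (simp add: complex_norm_square[symmetric])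
    have \<omega>m: "\<omega> ^ m = 1" using m0 by (simp add: \<omega>_def Complex.DeMoivre)
    have q_le: "norm (q j) \<le> 1" for j
    proof -
      have "norm (\<Sum>k<m. (\<omega> ^ j * cnj \<omega> ^ n) ^ k) \<le> (\<Sum>k<m. norm ((\<omega> ^ j * cnj \<omega> ^ n) ^ k))"
        by (rule norm_sum)
      also have "\<dots> = real m" by (simp add: norm_mult norm_power)
      finally show ?thesis using m0 by (simp add: q_def norm_divide)
    qed
    have q_n: "q n = 1" using inv m0 by (simp add: q_def flip: power_mult_distrib)
    have q_0: "q j = 0" if j: "j < m" "j \<noteq> n" for j
    proof -
      have "\<omega> ^ j \<noteq> \<omega> ^ n"
      proof
        assume "\<omega> ^ j = \<omega> ^ n"
        moreover have "\<omega> ^ i = exp (2 * of_real pi * \<i> * of_nat i / of_nat m)" for i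
          unfolding \<omega>_def cis_conv_exp exp_of_nat_mult[symmetric] by (simp add: field_simps)
        ultimately have "j mod m = n mod m"
          using complex_root_unity_eq[of m j n] m0 by simp
        then show False using j m by simp
      qed
      moreover have "\<omega> ^ n * (\<omega> ^ j * cnj \<omega> ^ n) = \<omega> ^ j * (\<omega> * cnj \<omega>) ^ n"
        by (simp add: power_mult_distrib mult_ac)
      ultimately have "\<omega> ^ j * cnj \<omega> ^ n \<noteq> 1"
        using inv by (metis mult.right_neutral power_one)
      \<comment> \<open>The ratio of the geometric sum is an \<open>m\<close>-th root of unity
        different from 1, so the sum vanishes.\<close>
      moreover have "(\<omega> ^ j * cnj \<omega> ^ n) ^ m = (\<omega> ^ m) ^ j * cnj (\<omega> ^ m) ^ n"
        by (simp add: power_mult_distrib mult.commute flip: power_mult)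
      then have "(\<omega> ^ j * cnj \<omega> ^ n) ^ m = 1" using \<omega>m by simp
      ultimately show ?thesis by (simp add: q_def sum_gp_strict)
    qed
    have "(\<lambda>j. (\<Sum>k<m. c j * (\<omega> ^ k * z) ^ j * cnj \<omega> ^ (k * n)) / of_nat m) sums unity_average f n m z"
      unfolding unity_average_def \<omega>_def[symmetric]
      by (intro sums_divide sums_sum sums_mult2 f)
    also have "(\<lambda>j. (\<Sum>k<m. c j * (\<omega> ^ k * z) ^ j * cnj \<omega> ^ (k * n)) / of_nat m) = (\<lambda>j. c j * z ^ j * q j)"
      unfolding q_def
      by (simp add: sum_distrib_left power_mult_distrib mult_ac flip: power_mult)
    finally have sums: "(\<lambda>j. c j * z ^ j * q j) sums unity_average f n m z" .
    have "(\<lambda>j. c (j + m) * z ^ (j + m) * q (j + m)) sums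
        (unity_average f n m z - (\<Sum>j<m. c j * z ^ j * q j))"
      by (rule sums_split_initial_segment[OF sums])
    also have "(\<Sum>j<m. c j * z ^ j * q j) = (\<Sum>j<m. if j = n then c n * z ^ n else 0)"
      by (intro sum.cong) (auto simp: q_n q_0)
    also have "\<dots> = c n * z ^ n" using m by simp
    finally have s: "(\<lambda>j. c (j + m) * z ^ (j + m) * q (j + m)) sums (unity_average f n m z - c n * z ^ n)" .
    have le: "norm (c (j + m) * z ^ (j + m) * q (j + m)) \<le> norm (c (j + m) * z ^ (j + m))" for j
      using mult_left_le[OF q_le[of "j + m"] norm_ge_zero[of "c (j + m) * z ^ (j + m)"]]
      by (simp add: norm_mult)
    have sm: "summable (\<lambda>j. norm (c (j + m) * z ^ (j + m)))"
      using abs[of z] by (subst summable_iff_shift[of "\<lambda>j. norm (c j * z ^ j)"])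
    have sm': "summable (\<lambda>j. norm (c (j + m) * z ^ (j + m) * q (j + m)))"
      by (rule summable_comparison_test'[OF sm]) (use le in auto)
    have "norm (unity_average f n m z - c n * z ^ n) \<le> (\<Sum>j. norm (c (j + m) * z ^ (j + m) * q (j + m)))"
      using summable_norm[OF sm'] sums_unique[OF s] by simp
    also have "\<dots> \<le> T m" unfolding T_def by (rule suminf_le[OF le sm' sm])
    finally show ?thesis .
  qed
  then have "\<forall>\<^sub>F m in sequentially. norm (unity_average f n m z - c n * z ^ n) \<le> T m"
    by (rule eventually_mono[OF eventually_gt_at_top[of n]])
  then have "(\<lambda>m. unity_average f n m z - c n * z ^ n) \<longlonglongrightarrow> 0"
    by (rule Lim_null_comparison[OF _ T])
  then show ?thesis by (simp add: LIM_zero_iff)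
qed

text \<open>Cauchy's estimate, obtained by passing to the limit in the averages over the circle of
  radius \<open>r\<close>.\<close>

lemma coeff_power_le:
  assumes f: "\<And>z. (\<lambda>n. c n * z ^ n) sums f z" and "r \<ge> 0"
    and B: "\<And>z. cmod z = r \<Longrightarrow> cmod (f z) \<le> B"
  shows "cmod (c n) * r ^ n \<le> B"
proof -
  have *: "norm (unity_average f n m (of_real r)) \<le> B" if "m > 0" for m
  proof -
    have "norm (\<Sum>k<m. f (cis (2 * pi / m) ^ k * of_real r) * cnj (cis (2 * pi / m)) ^ (k * n)) \<le> (\<Sum>k<m. B)"
      by (rule sum_norm_le) (auto simp: norm_mult norm_power \<open>r \<ge> 0\<close> intro!: B)
    then show ?thesis using that by (simp add: unity_average_def norm_divide field_simps)
  qed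
  have "norm (c n * of_real r ^ n) \<le> B"
    by (rule Lim_norm_ubound[OF _ unity_average_tendsto[OF f] eventually_mono[OF eventually_gt_at_top[of 0] *]])
       auto
  then show ?thesis using \<open>r \<ge> 0\<close> by (simp add: norm_mult norm_power)
qed

text \<open>Using the coefficient bound at radius \<open>r / q\<close> with
  \<open>q powr a = s / s'\<close> gains the geometric factor \<open>q ^ n\<close> and raises
  \<open>s\<close> only to \<open>s'\<close>. The factor \<open>(real n + 1) ^ 3\<close> is the
  quotient of the coefficients of the two critical examples constructed below.\<close>

lemma exp_bounded_power_series:
  fixes c :: "nat \<Rightarrow> complex"
  assumes "a > 0" "0 < s" "s < s'"
    and c: "\<And>n r. r \<ge> 0 \<Longrightarrow> cmod (c n) * r ^ n \<le> (real n + 1) ^ 3 * C * exp (s * r powr a)"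
  shows "summable (\<lambda>n. norm (c n * z ^ n))"
    and "(\<And>z. (\<lambda>n. c n * z ^ n) sums f z) \<Longrightarrow> exp_bounded s' a f"
proof -
  define q where "q = (s / s') powr (1 / a)"
  have "(s / s') powr (1 / a) < 1 powr (1 / a)"
    using assms by (intro powr_less_mono2) auto
  then have q: "0 < q" "q < 1" using assms by (auto simp: q_def)
  have qa: "s * (r / q) powr a = s' * r powr a" if "r \<ge> 0" for r
  proof -
    have "q powr a = s / s'" using assms by (simp add: q_def powr_powr)
    then show ?thesis using assms q that by (simp add: powr_divide field_simps)
  qed
  define S where "S = (\<lambda>n. (real n + 1) ^ 3 * q ^ n)"
  define l where "l = - ln q"
  have l: "l > 0" "q = exp (- l)" using q by (auto simp: l_def)
  \<comment> \<open>The polynomial costs at most the square root of the geometric factor.\<close>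
  have "(\<lambda>n::nat. (real n + 1) ^ 3 * exp (- (l * real n))) \<in> O(\<lambda>n. exp (- (l / 2 * real n)))"
    using l by real_asymp
  moreover have "exp (- (l * real n)) = q ^ n" "exp (- (l / 2 * real n)) = exp (- (l / 2)) ^ n" for n
    using l by (simp_all add: exp_of_nat2_mult[symmetric])
  ultimately have "S \<in> O(\<lambda>n. exp (- (l / 2)) ^ n)" by (simp add: S_def)
  moreover have "summable (\<lambda>n. norm (exp (- (l / 2)) ^ n))"
    using l by (auto simp: norm_power intro!: summable_geometric)
  ultimately have S: "summable S"
    by (intro summable_comparison_test_bigo[where f = S])
  have le: "norm (c n * z ^ n) \<le> S n * (C * exp (s' * cmod z powr a))" for n z
  proof -
    have "norm (c n * z ^ n) = q ^ n * (cmod (c n) * (cmod z / q) ^ n)"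
      using q by (simp add: norm_mult norm_power field_simps)
    also have "\<dots> \<le> q ^ n * ((real n + 1) ^ 3 * C * exp (s * (cmod z / q) powr a))"
      using q by (intro mult_left_mono c) auto
    finally show ?thesis by (simp add: qa S_def mult_ac)
  qed
  have Sm: "summable (\<lambda>n. S n * (C * exp (s' * cmod z powr a)))" for z
    by (intro summable_mult2 S)
  show sm: "summable (\<lambda>n. norm (c n * z ^ n))" for z
    by (rule summable_comparison_test'[OF Sm[of z]]) (use le in auto)
  show "exp_bounded s' a f" if f: "\<And>z. (\<lambda>n. c n * z ^ n) sums f z"
    unfolding exp_bounded_def
  proof (intro exI allI)
    fix z
    have "cmod (f z) \<le> (\<Sum>n. norm (c n * z ^ n))"
      using summable_norm[OF sm[of z]] sums_unique[OF f[of z]] by simp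
    also have "\<dots> \<le> (\<Sum>n. S n * (C * exp (s' * cmod z powr a)))"
      by (rule suminf_le[OF le sm Sm])
    also have "\<dots> = suminf S * C * exp (s' * cmod z powr a)"
      by (subst suminf_mult2[symmetric, OF S]) (simp add: mult_ac)
    finally show "cmod (f z) \<le> suminf S * C * exp (s' * cmod z powr a)" .
  qed
qed

section \<open>Coefficients and the norm of the Bargmann space\<close>

context log_asymptotic_weight
begin

lemma sqnorm_monomial: "sqnorm (\<lambda>z. c * z ^ n) = ennreal ((cmod c)\<^sup>2 * \<rho> n)"
proof -
  have "sqnorm (\<lambda>z. c * z ^ n) =
      (\<integral>\<^sup>+ z. ennreal (W' ((cmod z)\<^sup>2) / pi * ((cmod c)\<^sup>2 * ((cmod z)\<^sup>2) ^ n)) \<partial>lborel)"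
    unfolding sqnorm_def
    by (simp add: norm_mult norm_power power_mult_distrib mult.commute flip: power_mult)
  also have "\<dots> = (\<integral>\<^sup>+ x. ennreal (W' x * ((cmod c)\<^sup>2 * x ^ n)) * indicator {0<..} x \<partial>lborel)"
    by (rule sqnorm_radial[of "\<lambda>x. (cmod c)\<^sup>2 * x ^ n"]) auto
  also have "\<dots> = (\<integral>\<^sup>+ x. ennreal ((cmod c)\<^sup>2) * (ennreal (W' x * x ^ n) * indicator {0<..} x) \<partial>lborel)"
    using W'(2) by (intro nn_integral_cong) (auto simp: indicator_def ennreal_mult'[symmetric] mult_ac)
  also have "\<dots> = ennreal ((cmod c)\<^sup>2) * ennreal (\<rho> n)"
    by (subst nn_integral_cmult) (auto simp: nn_integral_moment)
  finally show ?thesis using \<rho>_pos[of n] by (simp add: ennreal_mult)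
qed

text \<open>By Cauchy-Schwarz the square of a mean is at most the mean of the squares, and every
  rotated copy of \<open>f\<close> has the same norm as \<open>f\<close>.\<close>

lemma sqnorm_unity_average_le:
  assumes [measurable]: "f \<in> borel_measurable borel" and m: "m > 0"
  shows "sqnorm (unity_average f n m) \<le> sqnorm f"
proof -
  define \<omega> where "\<omega> = cis (2 * pi / m)"
  have [simp]: "cmod \<omega> = 1" by (simp add: \<omega>_def)
  define g where "g = (\<lambda>z. ennreal (W' ((cmod z)\<^sup>2) / pi * (cmod (f z))\<^sup>2))"
  have [measurable]: "g \<in> borel_measurable borel" unfolding g_def by measurable
  have le: "(cmod (unity_average f n m z))\<^sup>2 \<le> (\<Sum>k<m. (cmod (f (\<omega> ^ k * z)))\<^sup>2) / m" for z
  proof -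
    have "cmod (unity_average f n m z) \<le> (\<Sum>k<m. cmod (f (\<omega> ^ k * z))) / m"
      unfolding unity_average_def \<omega>_def[symmetric] norm_divide
      by (auto intro!: divide_right_mono sum_norm_le simp: norm_mult norm_power)
    then have "(cmod (unity_average f n m z))\<^sup>2 \<le> ((\<Sum>k<m. cmod (f (\<omega> ^ k * z))) / m)\<^sup>2"
      by (intro power_mono) auto
    also have "\<dots> \<le> ((\<Sum>k<m. (cmod (f (\<omega> ^ k * z)))\<^sup>2) * m) / (real m)\<^sup>2"
      unfolding power_divide
      using sum_squared_le_sum_of_squares[of "\<lambda>k. cmod (f (\<omega> ^ k * z))" "{..<m}"] m
      by (intro divide_right_mono) (auto simp: mult.commute)
    also have "\<dots> = (\<Sum>k<m. (cmod (f (\<omega> ^ k * z)))\<^sup>2) / m"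
      using m by (simp add: power2_eq_square)
    finally show ?thesis .
  qed
  have "sqnorm (unity_average f n m) \<le> (\<integral>\<^sup>+ z. ennreal (1/m) * (\<Sum>k<m. g (\<omega> ^ k * z)) \<partial>lborel)"
    unfolding sqnorm_def
  proof (rule nn_integral_mono)
    fix z
    define V where "V = W' ((cmod z)\<^sup>2) / pi"
    have V: "V \<ge> 0" using W'(2) by (simp add: V_def)
    have "ennreal (V * (cmod (unity_average f n m z))\<^sup>2) \<le> ennreal (V * ((\<Sum>k<m. (cmod (f (\<omega> ^ k * z)))\<^sup>2) / m))"
      using le V by (intro ennreal_leI mult_left_mono)
    also have "V * ((\<Sum>k<m. (cmod (f (\<omega> ^ k * z)))\<^sup>2) / m) = 1/m * (\<Sum>k<m. V * (cmod (f (\<omega> ^ k * z)))\<^sup>2)"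
      by (simp add: sum_distrib_left sum_divide_distrib)
    also have "ennreal \<dots> = ennreal (1/m) * (\<Sum>k<m. g (\<omega> ^ k * z))"
    proof -
      have "(\<Sum>k<m. g (\<omega> ^ k * z)) = (\<Sum>k<m. ennreal (V * (cmod (f (\<omega> ^ k * z)))\<^sup>2))"
        by (simp add: g_def V_def norm_mult norm_power)
      also have "\<dots> = ennreal (\<Sum>k<m. V * (cmod (f (\<omega> ^ k * z)))\<^sup>2)"
        using V by (intro sum_ennreal) auto
      finally show ?thesis by (simp add: ennreal_mult'[symmetric])
    qed
    finally show "ennreal (W' ((cmod z)\<^sup>2) / pi * (cmod (unity_average f n m z))\<^sup>2)
        \<le> ennreal (1/m) * (\<Sum>k<m. g (\<omega> ^ k * z))" by (simp add: V_def)
  qed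
  also have "\<dots> = ennreal (1/m) * (\<Sum>k<m. \<integral>\<^sup>+ z. g (\<omega> ^ k * z) \<partial>lborel)"
    by (subst nn_integral_cmult, measurable) (subst nn_integral_sum, auto)
  also have "\<dots> = ennreal (1/m) * (\<Sum>k<m. \<integral>\<^sup>+ z. g z \<partial>lborel)"
    by (subst nn_integral_rotate) (auto simp: norm_power)
  also have "\<dots> = (ennreal (1/m) * ennreal (real m)) * sqnorm f"
    by (simp add: sqnorm_def g_def mult.assoc ennreal_of_nat_eq_real_of_nat)
  also have "ennreal (1/m) * ennreal (real m) = 1"
    using m by (simp add: ennreal_mult'[symmetric])
  finally show ?thesis by simp
qed

text \<open>The averages converge pointwise to the monomial of degree \<open>n\<close>, whose
  squared norm is the left side, and none exceeds \<open>f\<close> in norm; Fatou's lemma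
  concludes.\<close>

lemma coeff_sqnorm_le:
  assumes f: "\<And>z. (\<lambda>n. c n * z ^ n) sums f z"
  shows "ennreal ((cmod (c n))\<^sup>2 * \<rho> n) \<le> sqnorm f"
proof -
  have [measurable]: "f \<in> borel_measurable borel"
    using entire_power_series_holomorphic[OF f] by (rule holomorphic_borel_measurable)
  define h where "h = (\<lambda>m z. ennreal (W' ((cmod z)\<^sup>2) / pi * (cmod (unity_average f n m z))\<^sup>2))"
  have [measurable]: "h m \<in> borel_measurable borel" for m
    unfolding h_def unity_average_def by measurable
  have lim: "liminf (\<lambda>m. h m z) = ennreal (W' ((cmod z)\<^sup>2) / pi * (cmod (c n * z ^ n))\<^sup>2)" for z
    unfolding h_def by (intro lim_imp_Liminf tendsto_intros unity_average_tendsto f) auto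
  have "ennreal ((cmod (c n))\<^sup>2 * \<rho> n) = (\<integral>\<^sup>+ z. liminf (\<lambda>m. h m z) \<partial>lborel)"
    by (simp add: lim sqnorm_monomial[symmetric] sqnorm_def)
  also have "\<dots> \<le> liminf (\<lambda>m. \<integral>\<^sup>+ z. h m z \<partial>lborel)"
    by (rule nn_integral_liminf) auto
  also have "\<dots> \<le> sqnorm f"
  proof (rule Liminf_le)
    show "\<forall>\<^sub>F m in sequentially. (\<integral>\<^sup>+ z. h m z \<partial>lborel) \<le> sqnorm f"
      using eventually_gt_at_top[of 0]
      by eventually_elim (use sqnorm_unity_average_le in \<open>auto simp: h_def sqnorm_def\<close>)
  qed auto
  finally show ?thesis .
qed

text \<open>Multiplying the hypothesis by the moment estimate removes \<open>\<rho> n\<close> and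
  leaves the input of \<open>exp_bounded_power_series\<close>. It serves members of the Bargmann
  space, the critical examples and the functions representing Hilbert space vectors alike.\<close>

lemma coeff_exp_bounded:
  assumes c: "\<And>n. cmod (c n) * sqrt (\<rho> n) \<le> (real n + 1) ^ 3 * K"
  shows "summable (\<lambda>n. norm (c n * z ^ n))"
    and "(\<And>z. (\<lambda>n. c n * z ^ n) sums f z) \<Longrightarrow> s > b \<Longrightarrow> exp_bounded s a f"
proof -
  have *: "\<exists>C. \<forall>n. \<forall>r\<ge>0. cmod (c n) * r ^ n \<le> (real n + 1) ^ 3 * C * exp (s * r powr a)" if s: "s > b" for s
  proof -
    obtain C where C: "C > 0" "\<And>n r. r \<ge> 0 \<Longrightarrow> r ^ n \<le> C * exp (s * r powr a) * sqrt (\<rho> n)"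
      using power_le_exp_sqrt_moment[OF s] by blast
    have "cmod (c n) * r ^ n \<le> (real n + 1) ^ 3 * (K * C) * exp (s * r powr a)" if "r \<ge> 0" for n r
    proof -
      have "cmod (c n) * r ^ n \<le> cmod (c n) * (C * exp (s * r powr a) * sqrt (\<rho> n))"
        using C(2)[OF that] by (intro mult_left_mono) auto
      also have "\<dots> = (cmod (c n) * sqrt (\<rho> n)) * (C * exp (s * r powr a))" by simp
      also have "\<dots> \<le> ((real n + 1) ^ 3 * K) * (C * exp (s * r powr a))"
        using C(1) by (intro mult_right_mono c) auto
      finally show ?thesis by (simp add: mult_ac)
    qed
    then show ?thesis by blast
  qed
  show "summable (\<lambda>n. norm (c n * z ^ n))"
  proof -
    obtain C where C: "\<forall>n. \<forall>r\<ge>0. cmod (c n) * r ^ n \<le> (real n + 1) ^ 3 * C * exp ((b + 1) * r powr a)"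
      using *[of "b + 1"] by auto
    show ?thesis
      by (rule exp_bounded_power_series(1)[where C = C and s = "b + 1" and s' = "b + 2", OF a_pos])
         (use C b_pos in auto)
  qed
  show "exp_bounded s a f" if f: "\<And>z. (\<lambda>n. c n * z ^ n) sums f z" and s: "s > b"
  proof -
    obtain s1 where s1: "b < s1" "s1 < s" using dense[OF s] by blast
    obtain C where C: "\<forall>n. \<forall>r\<ge>0. cmod (c n) * r ^ n \<le> (real n + 1) ^ 3 * C * exp (s1 * r powr a)"
      using *[OF s1(1)] by auto
    show ?thesis
      by (rule exp_bounded_power_series(2)[where C = C and s = s1 and c = c, OF a_pos])
         (use C s1 b_pos f in auto)
  qed
qed

section \<open>Inclusions between growth classes and the Bargmann space\<close>

lemma growth_less_subset_bargmann: "growth_less a b \<subseteq> bargmann_space W"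
proof
  fix f assume f: "f \<in> growth_less a b"
  then obtain s where "s < b" "exp_bounded s a f"
    using growth_less_imp_exp_bounded[OF f a_pos b_pos] by blast
  then show "f \<in> bargmann_space W"
    using f by (intro exp_bounded_imp_bargmann) (auto simp: growth_less_def)
qed

lemma bargmann_subset_growth_le: "bargmann_space W \<subseteq> growth_le a b"
proof
  fix f assume "f \<in> bargmann_space W"
  then have f: "f holomorphic_on UNIV" "sqnorm f < \<infinity>" by (auto simp: bargmann_space_iff)
  obtain c where c: "\<And>z. (\<lambda>n. c n * z ^ n) sums f z" using entire_power_series[OF f(1)] by blast
  define K where "K = sqrt (enn2real (sqnorm f))"
  have "cmod (c n) * sqrt (\<rho> n) \<le> (real n + 1) ^ 3 * K" for n
  proof -
    have "(cmod (c n))\<^sup>2 * \<rho> n \<le> enn2real (sqnorm f)"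
      using coeff_sqnorm_le[OF c, of n] f(2) \<rho>_pos[of n]
      by (metis enn2real_ennreal enn2real_mono infinity_ennreal_def mult_nonneg_nonneg
            less_imp_le zero_le_power2)
    then have "sqrt ((cmod (c n))\<^sup>2 * \<rho> n) \<le> K" unfolding K_def by simp
    then have "cmod (c n) * sqrt (\<rho> n) \<le> K" by (simp add: real_sqrt_mult)
    also have "K \<le> (real n + 1) ^ 3 * K"
      using mult_right_mono[of 1 "(real n + 1) ^ 3" K] by (simp add: K_def one_le_power)
    finally show ?thesis .
  qed
  from coeff_exp_bounded(2)[OF this c] show "f \<in> growth_le a b"
    by (intro exp_bounded_imp_growth_le f a_pos b_pos)
qed

text \<open>Cauchy-Schwarz with the weights \<open>1 / (real n + 1)\<close> and
  \<open>real n + 1\<close> is applied pointwise before integrating. The orthogonality of the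
  monomials is thereby avoided at the price of the factor
  \<open>(real n + 1)\<^sup>2\<close>.\<close>

lemma sqnorm_le_coeffs:
  assumes f: "\<And>z. (\<lambda>n. c n * z ^ n) sums f z"
  shows "sqnorm f \<le> ennreal (\<Sum>n. 1 / (real n + 1)\<^sup>2) *
           (\<Sum>n. ennreal ((real n + 1)\<^sup>2 * ((cmod (c n))\<^sup>2 * \<rho> n)))"
proof -
  define S where "S = (\<Sum>n. 1 / (real n + 1)\<^sup>2)"
  have smS: "summable (\<lambda>n. 1 / (real n + 1)\<^sup>2)"
    using inverse_squares_sums sums_summable by (auto simp: add.commute)
  have S: "S \<ge> 0" unfolding S_def by (intro suminf_nonneg smS) auto
  have pt: "ennreal ((cmod (f z))\<^sup>2) \<le> ennreal S * (\<Sum>n. ennreal ((real n + 1)\<^sup>2 * (cmod (c n * z ^ n))\<^sup>2))" for z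
  proof (rule LIMSEQ_le_const2)
    show "(\<lambda>N. ennreal ((cmod (\<Sum>n<N. c n * z ^ n))\<^sup>2)) \<longlonglongrightarrow> ennreal ((cmod (f z))\<^sup>2)"
      using f[of z] unfolding sums_def by (intro tendsto_intros)
    have "ennreal ((cmod (\<Sum>n<N. c n * z ^ n))\<^sup>2) \<le> ennreal S * (\<Sum>n. ennreal ((real n + 1)\<^sup>2 * (cmod (c n * z ^ n))\<^sup>2))" for N
    proof -
      have "(cmod (\<Sum>n<N. c n * z ^ n))\<^sup>2 \<le> (\<Sum>n<N. (1 / (real n + 1)) * ((real n + 1) * cmod (c n * z ^ n)))\<^sup>2"
        by (intro power_mono) (auto intro!: sum_norm_le simp: field_simps)
      also have "\<dots> \<le> (\<Sum>n<N. (1 / (real n + 1))\<^sup>2) * (\<Sum>n<N. ((real n + 1) * cmod (c n * z ^ n))\<^sup>2)"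
        by (rule Cauchy_Schwarz_ineq_sum)
      also have "\<dots> \<le> S * (\<Sum>n<N. ((real n + 1) * cmod (c n * z ^ n))\<^sup>2)"
        unfolding S_def power_divide one_power2
        by (intro mult_right_mono sum_le_suminf smS sum_nonneg) auto
      finally have "ennreal ((cmod (\<Sum>n<N. c n * z ^ n))\<^sup>2) \<le>
           ennreal (S * (\<Sum>n<N. ((real n + 1) * cmod (c n * z ^ n))\<^sup>2))" by (rule ennreal_leI)
      also have "\<dots> = ennreal S * ennreal (\<Sum>n<N. ((real n + 1) * cmod (c n * z ^ n))\<^sup>2)"
        by (rule ennreal_mult'[OF S])
      also have "ennreal (\<Sum>n<N. ((real n + 1) * cmod (c n * z ^ n))\<^sup>2) =
           (\<Sum>n<N. ennreal (((real n + 1) * cmod (c n * z ^ n))\<^sup>2))"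
        by (intro sum_ennreal[symmetric]) auto
      also have "ennreal S * (\<Sum>n<N. ennreal (((real n + 1) * cmod (c n * z ^ n))\<^sup>2)) \<le>
           ennreal S * (\<Sum>n. ennreal (((real n + 1) * cmod (c n * z ^ n))\<^sup>2))"
        by (intro mult_left_mono sum_le_suminf) auto
      finally show ?thesis by (simp add: power_mult_distrib)
    qed
    then show "\<exists>M. \<forall>N\<ge>M. ennreal ((cmod (\<Sum>n<N. c n * z ^ n))\<^sup>2) \<le>
        ennreal S * (\<Sum>n. ennreal ((real n + 1)\<^sup>2 * (cmod (c n * z ^ n))\<^sup>2))"
      by (intro exI allI impI)
  qed
  have "sqnorm f \<le> (\<integral>\<^sup>+ z. ennreal S * (\<Sum>n. ennreal ((real n + 1)\<^sup>2) *
      ennreal (W' ((cmod z)\<^sup>2) / pi * (cmod (c n * z ^ n))\<^sup>2)) \<partial>lborel)"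
    unfolding sqnorm_def
  proof (rule nn_integral_mono)
    fix z
    define V where "V = W' ((cmod z)\<^sup>2) / pi"
    have V: "V \<ge> 0" using W'(2) by (simp add: V_def)
    have "ennreal (V * (cmod (f z))\<^sup>2) \<le> ennreal V * (ennreal S * (\<Sum>n. ennreal ((real n + 1)\<^sup>2 * (cmod (c n * z ^ n))\<^sup>2)))"
      using V pt by (simp add: ennreal_mult mult_left_mono)
    also have "\<dots> = ennreal S * (\<Sum>n. ennreal V * ennreal ((real n + 1)\<^sup>2 * (cmod (c n * z ^ n))\<^sup>2))"
      by (simp add: mult_ac)
    also have "\<dots> = ennreal S * (\<Sum>n. ennreal ((real n + 1)\<^sup>2) * ennreal (V * (cmod (c n * z ^ n))\<^sup>2))"
      using V by (simp add: ennreal_mult'[symmetric] mult_ac)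
    finally show "ennreal (W' ((cmod z)\<^sup>2) / pi * (cmod (f z))\<^sup>2) \<le> ennreal S * (\<Sum>n. ennreal ((real n + 1)\<^sup>2) *
      ennreal (W' ((cmod z)\<^sup>2) / pi * (cmod (c n * z ^ n))\<^sup>2))" by (simp add: V_def)
  qed
  also have "\<dots> = ennreal S * (\<Sum>n. ennreal ((real n + 1)\<^sup>2) * sqnorm (\<lambda>z. c n * z ^ n))"
    unfolding sqnorm_def
    by (subst nn_integral_cmult, measurable) (subst nn_integral_suminf, measurable, subst nn_integral_cmult, auto)
  finally show ?thesis using \<rho>_pos
    by (simp add: sqnorm_monomial S_def ennreal_mult'[symmetric])
qed

section \<open>Functions of critical growth inside and outside the space\<close>

text \<open>By \<open>coeff_sqnorm_le\<close> the squared norm would be at least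
  \<open>(real n + 1)\<^sup>2\<close> for every \<open>n\<close>. The series stays visible in the
  statement because the next lemma compares coefficients with it.\<close>

lemma critical_growth_not_bargmann:
  "\<exists>f. (\<forall>z. (\<lambda>n. of_real ((real n + 1) / sqrt (\<rho> n)) * z ^ n) sums f z) \<and>
    f \<in> growth_le a b \<and> f \<notin> bargmann_space W"
proof -
  define c where "c = (\<lambda>n. complex_of_real ((real n + 1) / sqrt (\<rho> n)))"
  define f where "f = (\<lambda>z. \<Sum>n. c n * z ^ n)"
  have bd: "cmod (c n) * sqrt (\<rho> n) \<le> (real n + 1) ^ 3 * 1" for n
    using \<rho>_pos[of n] power_increasing[of 1 3 "real n + 1"] by (simp add: c_def norm_divide del: of_real_divide)
  have f: "(\<lambda>n. c n * z ^ n) sums f z" for z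
    unfolding f_def by (intro summable_sums summable_norm_cancel[OF coeff_exp_bounded(1)[OF bd]])
  have "f \<in> growth_le a b"
    by (intro exp_bounded_imp_growth_le a_pos b_pos entire_power_series_holomorphic[OF f] coeff_exp_bounded(2)[OF bd f])
  moreover have "f \<notin> bargmann_space W"
  proof
    assume "f \<in> bargmann_space W"
    then have fin: "sqnorm f < \<infinity>" by (simp add: bargmann_space_iff)
    then obtain B where B: "B \<ge> 0" "sqnorm f = ennreal B" by (cases "sqnorm f") auto
    have "(real n + 1)\<^sup>2 \<le> B" for n
    proof -
      have "(cmod (c n))\<^sup>2 * \<rho> n = (real n + 1)\<^sup>2"
        using \<rho>_pos[of n] by (simp add: c_def norm_divide power_divide del: of_real_divide)
      then show ?thesis using coeff_sqnorm_le[OF f, of n] B by simp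
    qed
    moreover obtain n where "real n > B" using reals_Archimedean2 by blast
    moreover have "real n \<le> (real n + 1)\<^sup>2" by (simp add: power2_eq_square algebra_simps)
    ultimately show False by (metis leD order_trans)
  qed
  ultimately show ?thesis using f unfolding c_def by blast
qed

text \<open>With coefficients \<open>(n+1)^(-2)\<close> over \<open>sqrt (\<rho> n)\<close> the
  bound of \<open>sqnorm_le_coeffs\<close> is finite. If the growth were subcritical, Cauchy's
  estimate and \<open>exp_bounded_power_series\<close> would make the preceding example subcritical
  too, hence a member of the space.\<close>

lemma critical_growth_bargmann:
  obtains f where "f \<in> bargmann_space W" "f \<notin> growth_less a b"
proof -
  define c where "c = (\<lambda>n. complex_of_real (1 / ((real n + 1)\<^sup>2 * sqrt (\<rho> n))))"
  define f where "f = (\<lambda>z. \<Sum>n. c n * z ^ n)"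
  have bd: "cmod (c n) * sqrt (\<rho> n) \<le> (real n + 1) ^ 3 * 1" for n
  proof -
    have "cmod (c n) * sqrt (\<rho> n) = 1 / (real n + 1)\<^sup>2"
      using \<rho>_pos[of n] by (simp add: c_def norm_divide norm_mult del: of_real_divide)
    also have "\<dots> \<le> 1" by simp
    also have "1 \<le> (real n + 1) ^ 3 * 1" by (simp add: one_le_power)
    finally show ?thesis .
  qed
  have f: "(\<lambda>n. c n * z ^ n) sums f z" for z
    unfolding f_def by (intro summable_sums summable_norm_cancel[OF coeff_exp_bounded(1)[OF bd]])
  have hol: "f holomorphic_on UNIV" by (rule entire_power_series_holomorphic[OF f])
  have "sqnorm f \<le> ennreal (\<Sum>n. 1 / (real n + 1)\<^sup>2) * (\<Sum>n. ennreal (1 / (real n + 1)\<^sup>2))"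
  proof -
    have "(real n + 1)\<^sup>2 * ((cmod (c n))\<^sup>2 * \<rho> n) = 1 / (real n + 1)\<^sup>2" for n
    proof -
      have eq: "x * ((1 / (x * r))\<^sup>2 * r\<^sup>2) = 1 / x" if "x \<noteq> 0" "r \<noteq> 0" for x r :: real
        using that by (simp add: field_simps power2_eq_square)
      have "cmod (c n) = 1 / ((real n + 1)\<^sup>2 * sqrt (\<rho> n))"
        using \<rho>_pos[of n] by (simp add: c_def norm_divide norm_mult del: of_real_divide)
      moreover have "\<rho> n = (sqrt (\<rho> n))\<^sup>2" using \<rho>_pos[of n] by simp
      moreover have "(real n + 1)\<^sup>2 \<noteq> 0" by simp
      ultimately show ?thesis using eq[of "(real n + 1)\<^sup>2" "sqrt (\<rho> n)"] \<rho>_pos[of n]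
        by (metis less_irrefl real_sqrt_eq_zero_cancel_iff)
    qed
    then show ?thesis using sqnorm_le_coeffs[OF f] by simp
  qed
  also have "\<dots> < \<infinity>"
  proof -
    have "summable (\<lambda>n. 1 / (real n + 1)\<^sup>2)"
      using inverse_squares_sums sums_summable by (auto simp: add.commute)
    then have "(\<Sum>n. ennreal (1 / (real n + 1)\<^sup>2)) = ennreal (\<Sum>n. 1 / (real n + 1)\<^sup>2)"
      by (intro suminf_ennreal2) auto
    then show ?thesis by (simp add: ennreal_mult_less_top)
  qed
  finally have "f \<in> bargmann_space W" using hol by (simp add: bargmann_space_iff)
  moreover have "f \<notin> growth_less a b"
  proof
    assume fl: "f \<in> growth_less a b"
    obtain s where s: "0 < s" "s < b" "exp_bounded s a f"
      using growth_less_imp_exp_bounded[OF fl a_pos b_pos] .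
    then obtain C where C: "\<And>z. cmod (f z) \<le> C * exp (s * cmod z powr a)" by (auto simp: exp_bounded_def)
    define d where "d = (\<lambda>n. complex_of_real ((real n + 1) / sqrt (\<rho> n)))"
    obtain g where g: "\<And>z. (\<lambda>n. d n * z ^ n) sums g z" "g \<notin> bargmann_space W"
      using critical_growth_not_bargmann unfolding d_def by blast
    have d: "cmod (d n) * r ^ n \<le> (real n + 1) ^ 3 * C * exp (s * r powr a)" if "r \<ge> 0" for n r
    proof -
      have "cmod (c n) * r ^ n \<le> C * exp (s * r powr a)"
      proof (rule coeff_power_le[OF f that])
        show "cmod (f z) \<le> C * exp (s * r powr a)" if "cmod z = r" for z
          using C[of z] that by simp
      qed
      then have "(real n + 1) ^ 3 * (cmod (c n) * r ^ n) \<le> (real n + 1) ^ 3 * (C * exp (s * r powr a))"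
        by (intro mult_left_mono) auto
      moreover have "cmod (d n) = (real n + 1) ^ 3 * cmod (c n)"
      proof -
        have eq: "x / r = x ^ 3 * (1 / (x\<^sup>2 * r))" if "x \<noteq> 0" for x r :: real
          using that by (simp add: power3_eq_cube power2_eq_square)
        have "cmod (d n) = (real n + 1) / sqrt (\<rho> n)"
          using \<rho>_pos[of n] unfolding d_def norm_of_real by simp
        moreover have "cmod (c n) = 1 / ((real n + 1)\<^sup>2 * sqrt (\<rho> n))"
          using \<rho>_pos[of n] unfolding c_def norm_of_real by simp
        moreover have "real n + 1 \<noteq> 0" by linarith
        ultimately show ?thesis using eq[of "real n + 1" "sqrt (\<rho> n)"] by simp
      qed
      ultimately show ?thesis by (simp add: mult_ac)
    qed
    obtain s' where s': "s < s'" "s' < b" using dense[OF s(2)] by blast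
    have "exp_bounded s' a g"
      by (rule exp_bounded_power_series(2)[where c = d and s = s and C = C, OF a_pos]) (use d s s' g in auto)
    then have "g \<in> bargmann_space W"
      using s' entire_power_series_holomorphic[OF g(1)] by (intro exp_bounded_imp_bargmann)
    with g show False by blast
  qed
  ultimately show ?thesis using that by blast
qed

theorem bargmann_growth:
  "growth_less a b \<subseteq> bargmann_space W \<and> bargmann_space W \<subseteq> growth_le a b \<and>
      (\<exists>F. F holomorphic_on UNIV \<and> growth_order F = ereal a \<and> growth_type a F = ereal b \<and>
           F \<in> bargmann_space W) \<and>
      (\<exists>F. F holomorphic_on UNIV \<and> growth_order F = ereal a \<and> growth_type a F = ereal b \<and>
           F \<notin> bargmann_space W)"
proof (intro conjI)
  obtain f where f: "f \<in> bargmann_space W" "f \<notin> growth_less a b" by (rule critical_growth_bargmann)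
  moreover from this have "f holomorphic_on UNIV" by (simp add: bargmann_space_iff)
  ultimately show "\<exists>F. F holomorphic_on UNIV \<and> growth_order F = ereal a \<and> growth_type a F = ereal b \<and> F \<in> bargmann_space W"
    using growth_le_not_less[of f a b] bargmann_subset_growth_le by blast
  \<comment> \<open>This function is not in \<open>growth_less a b\<close> either, since that class
    lies in the Bargmann space; so its growth is exactly critical.\<close>
  obtain g where g: "g \<in> growth_le a b" "g \<notin> bargmann_space W" using critical_growth_not_bargmann by blast
  moreover from this have "g holomorphic_on UNIV" by (simp add: growth_le_def)
  ultimately show "\<exists>F. F holomorphic_on UNIV \<and> growth_order F = ereal a \<and> growth_type a F = ereal b \<and> F \<notin> bargmann_space W"
    using growth_le_not_less[of g a b] growth_less_subset_bargmann by blast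
qed (rule growth_less_subset_bargmann bargmann_subset_growth_le)+

end

section \<open>Orthogonality to coherent states\<close>

context complex_hilbert_onb
begin

lemma cinner_add_left: "cinner (x + y) z = cinner x z + cinner y z"
proof -
  have "cinner (x + y) z = cnj (cinner z (x + y))" by (rule cinner_commute)
  also have "\<dots> = cnj (cinner z x) + cnj (cinner z y)" by (simp add: cinner_add_right)
  finally show ?thesis by (simp only: cinner_commute[symmetric])
qed

lemma cinner_scaleC_left: "cinner (scaleC c x) y = cnj c * cinner x y"
proof -
  have "cinner (scaleC c x) y = cnj (cinner y (scaleC c x))" by (rule cinner_commute)
  also have "\<dots> = cnj c * cnj (cinner y x)" by (simp add: cinner_scaleC_right)
  finally show ?thesis by (simp only: cinner_commute[symmetric])
qed

lemma cinner_zero_right: "cinner x 0 = 0"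
  using cinner_scaleC_right[of x 0 x] by simp

lemma cinner_zero_left: "cinner 0 x = 0"
  using cinner_scaleC_left[of 0 x x] by simp

lemma cinner_self: "cinner x x = complex_of_real ((norm x)\<^sup>2)"
proof -
  \<comment> \<open>Positivity of the form comes from the norm: the real \<open>sqrt\<close> is
    negative on negative numbers.\<close>
  have "sqrt (Re (cinner x x)) \<ge> 0" using norm_ge_zero[of x] by (simp only: norm_eq_sqrt_cinner)
  then have "Re (cinner x x) = (norm x)\<^sup>2" by (simp add: norm_eq_sqrt_cinner)
  moreover have "Im (cinner x x) = 0" using cinner_commute[of x x] by (simp add: complex_eq_iff)
  ultimately show ?thesis by (simp add: complex_eq_iff)
qed

lemma norm_scaleC: "norm (scaleC c x) = cmod c * norm x"
proof -
  have "complex_of_real ((norm (scaleC c x))\<^sup>2) = c * cnj c * complex_of_real ((norm x)\<^sup>2)"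
    unfolding cinner_self[symmetric] by (simp add: cinner_scaleC_left cinner_scaleC_right)
  also have "\<dots> = complex_of_real ((cmod c * norm x)\<^sup>2)"
    by (simp only: complex_norm_square[symmetric] of_real_mult power_mult_distrib of_real_power)
  finally have "(norm (scaleC c x))\<^sup>2 = (cmod c * norm x)\<^sup>2" using of_real_eq_iff by blast
  then show ?thesis by (simp add: power2_eq_iff_nonneg)
qed

lemma cmod_cinner_le: "cmod (cinner x y) \<le> norm x * norm y"
proof (cases "x = 0")
  case False
  define N where "N = (norm x)\<^sup>2"
  have N: "N > 0" using False by (simp add: N_def)
  define p where "p = cinner x y"
  \<comment> \<open>This choice makes \<open>y + scaleC c x\<close> orthogonal to \<open>x\<close>;
    nonnegativity of its squared norm is the Cauchy-Schwarz inequality.\<close>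
  define c where "c = - (p / of_real N)"
  have yx: "cinner y x = cnj p" by (subst cinner_commute) (simp add: p_def)
  have "complex_of_real ((norm (y + scaleC c x))\<^sup>2) =
      of_real ((norm y)\<^sup>2) + c * cnj p + cnj c * p + cnj c * c * of_real N"
    unfolding cinner_self[symmetric] N_def
    by (simp add: cinner_add_left cinner_add_right
        cinner_scaleC_left cinner_scaleC_right p_def[symmetric] yx algebra_simps)
  also have "\<dots> = of_real ((norm y)\<^sup>2) - p * cnj p / of_real N"
    using N by (simp add: c_def field_simps)
  also have "\<dots> = complex_of_real ((norm y)\<^sup>2 - (cmod p)\<^sup>2 / N)"
    by (simp add: complex_norm_square[symmetric])
  finally have "(norm (y + scaleC c x))\<^sup>2 = (norm y)\<^sup>2 - (cmod p)\<^sup>2 / N"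
    using of_real_eq_iff by blast
  then have "(cmod p)\<^sup>2 / N \<le> (norm y)\<^sup>2"
    using zero_le_power2[of "norm (y + scaleC c x)"] by linarith
  then have "(cmod p)\<^sup>2 \<le> (norm x * norm y)\<^sup>2"
    using N by (simp add: N_def field_simps)
  then show ?thesis unfolding p_def by (rule power2_le_imp_le) simp
qed (simp add: cinner_zero_left)

lemma bounded_linear_cinner: "bounded_linear (cinner x)"
proof
  show "cinner x (r *\<^sub>R y) = r *\<^sub>R cinner x y" for r y
    by (simp add: scaleC_of_real[symmetric] cinner_scaleC_right scaleR_conv_of_real)
  show "\<exists>K. \<forall>y. norm (cinner x y) \<le> norm y * K"
    using cmod_cinner_le[of x] by (intro exI[of _ "norm x"]) (simp add: mult.commute)
qed (rule cinner_add_right)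

lemma norm_basis: "norm (e n) = 1"
  by (simp add: norm_eq_sqrt_cinner orthonormal)

text \<open>The orthogonal complement of \<open>x\<close> is a closed subspace containing the dense
  span, hence \<open>x\<close> itself.\<close>

lemma orthogonal_basis_imp_zero:
  assumes "\<And>n. cinner x (e n) = 0"
  shows "x = 0"
proof -
  have "module.subspace scaleC {y. cinner x y = 0}"
    unfolding subspace_def by (simp add: cinner_zero_right cinner_add_right cinner_scaleC_right)
  then have "span (range e) \<subseteq> {y. cinner x y = 0}"
    using assms by (intro span_minimal) auto
  moreover have "closed {y. cinner x y = 0}"
    by (intro closed_Collect_eq continuous_intros linear_continuous_on bounded_linear_cinner)
  ultimately have "closure (span (range e)) \<subseteq> {y. cinner x y = 0}"
    by (rule closure_minimal)
  then have "cinner x x = 0" using dense_span by auto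
  then show ?thesis by (simp add: cinner_self)
qed

end

section \<open>Coherent states and the entire functions representing vectors\<close>

locale coherent_states =
  complex_hilbert_onb scaleC cinner e + log_asymptotic_weight \<rho> W a b
  for scaleC :: "complex \<Rightarrow> 'h::banach \<Rightarrow> 'h" and cinner e \<rho> W a b +
  assumes summable_coherent_norm: "x \<ge> 0 \<Longrightarrow> summable (\<lambda>n. x ^ n / \<rho> n)"
begin

lemma summable_coherent: "summable (\<lambda>n. norm (complex_of_real (1 / sqrt (\<rho> n)) * z ^ n))"
proof (rule coeff_exp_bounded(1)[where K = 1])
  show "cmod (complex_of_real (1 / sqrt (\<rho> n))) * sqrt (\<rho> n) \<le> (real n + 1) ^ 3 * 1" for n
    using \<rho>_pos[of n] unfolding norm_of_real by (simp add: one_le_power)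
qed

lemma coherent_norm_pos: "x \<ge> 0 \<Longrightarrow> coherent_norm \<rho> x > 0"
  unfolding coherent_norm_def
proof (rule suminf_pos2[where i = 0])
  assume x: "x \<ge> 0"
  show "summable (\<lambda>n. x ^ n / \<rho> n)" by (rule summable_coherent_norm[OF x])
  show "0 \<le> x ^ n / \<rho> n" for n using x \<rho>_pos[of n] by simp
  show "0 < x ^ 0 / \<rho> 0" using \<rho>_pos[of 0] by simp
qed

text \<open>The state stands in the linear argument, so the series passes through the form
  unchanged. The resulting power series has the conjugates of the components of \<open>x\<close> in
  its coefficients, and its zeros are the points \<open>z\<close> themselves rather than their
  conjugates.\<close>

lemma cinner_coherent_state:
  "cinner x (coherent_state scaleC e \<rho> z) =
     complex_of_real (coherent_norm \<rho> ((cmod z)\<^sup>2) powr (- 1 / 2)) *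
     (\<Sum>n. cinner x (e n) / complex_of_real (sqrt (\<rho> n)) * z ^ n)"
proof -
  have "norm (scaleC (z ^ n / complex_of_real (sqrt (\<rho> n))) (e n)) =
      norm (complex_of_real (1 / sqrt (\<rho> n)) * z ^ n)" for n
    by (simp add: norm_scaleC norm_basis norm_mult norm_divide)
  then have "summable (\<lambda>n. norm (scaleC (z ^ n / complex_of_real (sqrt (\<rho> n))) (e n)))"
    using summable_coherent[of z] by (simp only:)
  then have "summable (\<lambda>n. scaleC (z ^ n / complex_of_real (sqrt (\<rho> n))) (e n))"
    by (rule summable_norm_cancel)
  note bounded_linear.suminf[OF bounded_linear_cinner this, of x]
  also have "(\<lambda>n. cinner x (scaleC (z ^ n / complex_of_real (sqrt (\<rho> n))) (e n))) =
      (\<lambda>n. cinner x (e n) / complex_of_real (sqrt (\<rho> n)) * z ^ n)"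
    by (simp add: cinner_scaleC_right mult.commute)
  finally show ?thesis
    unfolding coherent_state_def cinner_scaleC_right by (rule arg_cong)
qed

lemma cinner_coherent_state_zero_iff:
  "cinner (coherent_state scaleC e \<rho> z) x = 0 \<longleftrightarrow>
     (\<Sum>n. cinner x (e n) / complex_of_real (sqrt (\<rho> n)) * z ^ n) = 0"
proof -
  have "cinner (coherent_state scaleC e \<rho> z) x = 0 \<longleftrightarrow> cinner x (coherent_state scaleC e \<rho> z) = 0"
    using cinner_commute[of x "coherent_state scaleC e \<rho> z"]
      cinner_commute[of "coherent_state scaleC e \<rho> z" x] by (metis complex_cnj_zero)
  then show ?thesis
    using coherent_norm_pos[of "(cmod z)\<^sup>2"] by (simp add: cinner_coherent_state)
qed

text \<open>The components along \<open>e 0\<close> and \<open>e 1\<close> have a quotient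
  proportional to \<open>z\<close>. Injectivity ensures that deleting one state from the set deletes
  only one index.\<close>

lemma inj_coherent_state: "inj (coherent_state scaleC e \<rho>)"
proof (rule injI)
  fix z w assume eq: "coherent_state scaleC e \<rho> z = coherent_state scaleC e \<rho> w"
  define K where "K = (\<lambda>z. complex_of_real (coherent_norm \<rho> ((cmod z)\<^sup>2) powr (- 1 / 2)))"
  have K: "K z \<noteq> 0" for z using coherent_norm_pos[of "(cmod z)\<^sup>2"] by (simp add: K_def)
  have c: "cinner (e m) (coherent_state scaleC e \<rho> z) = K z * (z ^ m / of_real (sqrt (\<rho> m)))" for z m
  proof -
    have "(\<lambda>n. cinner (e m) (e n) / complex_of_real (sqrt (\<rho> n)) * z ^ n) =
        (\<lambda>n. if n = m then z ^ m / of_real (sqrt (\<rho> m)) else 0)"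
      by (auto simp: orthonormal fun_eq_iff)
    moreover have "(\<Sum>n. if n = m then z ^ m / of_real (sqrt (\<rho> m)) else 0) = z ^ m / complex_of_real (sqrt (\<rho> m))"
      using sums_unique[OF sums_single[of m "\<lambda>_. z ^ m / complex_of_real (sqrt (\<rho> m))"]] by simp
    ultimately show ?thesis by (simp add: cinner_coherent_state K_def)
  qed
  have r: "complex_of_real (sqrt (\<rho> m)) \<noteq> 0" for m using \<rho>_pos[of m] by simp
  have "K z = K w" using c[of 0 z] c[of 0 w] eq r[of 0] by simp
  moreover have "K z * z = K w * w" using c[of 1 z] c[of 1 w] eq r[of 1] by simp
  ultimately show "z = w" using K[of z] by simp
qed

text \<open>Cauchy-Schwarz bounds \<open>cinner x (e n)\<close> by \<open>norm x\<close>, which is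
  the hypothesis of \<open>coeff_exp_bounded\<close>.\<close>

lemma coherent_symbol:
  assumes "F = (\<lambda>z. \<Sum>n. cinner x (e n) / complex_of_real (sqrt (\<rho> n)) * z ^ n)"
  shows "(\<lambda>n. cinner x (e n) / complex_of_real (sqrt (\<rho> n)) * z ^ n) sums F z"
    and "s > b \<Longrightarrow> exp_bounded s a F"
proof -
  have bd: "cmod (cinner x (e n) / complex_of_real (sqrt (\<rho> n))) * sqrt (\<rho> n) \<le> (real n + 1) ^ 3 * norm x" for n
  proof -
    have "cmod (cinner x (e n)) \<le> 1 * norm x"
      using cmod_cinner_le[of x "e n"] by (simp add: norm_basis)
    also have "\<dots> \<le> (real n + 1) ^ 3 * norm x" by (intro mult_right_mono one_le_power) auto
    finally show ?thesis using \<rho>_pos[of n] by (simp add: norm_divide)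
  qed
  show s: "(\<lambda>n. cinner x (e n) / complex_of_real (sqrt (\<rho> n)) * z ^ n) sums F z" for z
    unfolding assms by (intro summable_sums summable_norm_cancel[OF coeff_exp_bounded(1)[OF bd]])
  show "exp_bounded s a F" if "s > b"
    by (rule coeff_exp_bounded(2)[OF bd s that])
qed

end

section \<open>Zeros of entire functions\<close>

text \<open>Jensen's inequality: each zero \<open>w\<close> is divided out by the Blaschke factor
  \<open>R (z - w) / (R\<^sup>2 - cnj w z)\<close>, which has modulus \<open>1\<close> on the circle.\<close>

lemma jensen_inequality:
  assumes "finite A" "f holomorphic_on UNIV" "R > 0"
    and "\<And>w. w \<in> A \<Longrightarrow> f w = 0 \<and> w \<noteq> 0 \<and> cmod w < R"
    and "\<And>z. cmod z = R \<Longrightarrow> cmod (f z) \<le> M"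
  shows "cmod (f 0) * R ^ card A \<le> M * (\<Prod>w\<in>A. cmod w)"
  using assms
proof (induction A arbitrary: f rule: finite_induct)
  case empty
  have "cmod (f 0) \<le> max_modulus f R" by (rule max_modulus_principle) (use empty in auto)
  also have "\<dots> \<le> M" by (rule max_modulus_least) (use empty in auto)
  finally show ?case by simp
next
  case (insert w A)
  have w: "f w = 0" "w \<noteq> 0" "cmod w < R" using insert.prems(3)[of w] by auto
  define f1 where "f1 = (\<lambda>z. if z = w then deriv f w else (f z - f w) / (z - w))"
  define g where "g = (\<lambda>z. f1 z * (of_real (R\<^sup>2) - cnj w * z) / of_real R)"
  have hol1: "f1 holomorphic_on UNIV"
    unfolding f1_def by (rule pole_lemma_open) (use insert.prems in auto)
  have "g holomorphic_on UNIV"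
    unfolding g_def by (intro holomorphic_intros hol1) (use \<open>R > 0\<close> in auto)
  moreover have "g v = 0 \<and> v \<noteq> 0 \<and> cmod v < R" if "v \<in> A" for v
    using that insert.prems(3)[of v] insert.hyps w by (auto simp: g_def f1_def)
  moreover have "cmod (g z) \<le> M" if z: "cmod z = R" for z
  proof -
    have zw: "z \<noteq> w" using z w by auto
    \<comment> \<open>On the circle \<open>R\<^sup>2\<close> equals \<open>z * cnj z\<close>, so the
      Blaschke factor has modulus 1 there.\<close>
    have "complex_of_real (R\<^sup>2) - cnj w * z = z * cnj (z - w)"
      unfolding z[symmetric] complex_norm_square by (simp add: algebra_simps flip: complex_norm_square)
    then have "cmod (complex_of_real (R\<^sup>2) - cnj w * z) = R * cmod (z - w)"
      by (simp add: norm_mult z flip: complex_cnj_diff)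
    then have "cmod (g z) = cmod (f z)"
      using zw w \<open>R > 0\<close> by (simp add: g_def f1_def norm_mult norm_divide)
    then show ?thesis using insert.prems(4)[OF z] by simp
  qed
  ultimately have "cmod (g 0) * R ^ card A \<le> M * (\<Prod>w\<in>A. cmod w)"
    using insert.IH[of g] \<open>R > 0\<close> by blast
  \<comment> \<open>At the origin, dividing out the zero gains the factor \<open>R / cmod w\<close>,
    which is what the induction accumulates.\<close>
  moreover have "cmod (g 0) = cmod (f 0) * R / cmod w"
    using w \<open>R > 0\<close> by (simp add: g_def f1_def norm_mult norm_divide power2_eq_square)
  ultimately show ?case
    using w insert.hyps by (simp add: field_simps)
qed

text \<open>The logarithm of Jensen's inequality with the exponential bound in place of the maximum.
  The index set \<open>I\<close> permits leaving out a zero, and injectivity turns the product over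
  points into a sum over indices.\<close>

lemma jensen_sum_ln_le:
  assumes f: "f holomorphic_on UNIV" "f 0 \<noteq> 0"
    and "exp_bounded s a f"
    and z: "\<And>N. N \<in> I \<Longrightarrow> f (z N) = 0" "inj z"
    and fin: "\<And>R. finite {N \<in> I. cmod (z N) < R}"
  obtains K where "\<And>R. R > 0 \<Longrightarrow> (\<Sum>N | N \<in> I \<and> cmod (z N) < R. ln (R / cmod (z N))) \<le> K + s * R powr a"
proof -
  obtain C0 where C0: "\<And>z. cmod (f z) \<le> C0 * exp (s * cmod z powr a)"
    using assms(3) by (auto simp: exp_bounded_def)
  define C where "C = max C0 1"
  have C: "C > 0" "\<And>z. cmod (f z) \<le> C * exp (s * cmod z powr a)"
    by (simp add: C_def) (rule order_trans[OF C0 mult_right_mono], auto simp: C_def)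
  show ?thesis
  proof (rule that)
    fix R :: real assume R: "R > 0"
    define J where "J = {N \<in> I. cmod (z N) < R}"
    have J: "finite J" using fin by (simp add: J_def)
    have nz: "z N \<noteq> 0" if "N \<in> I" for N using z(1)[OF that] f(2) by auto
    have pos: "0 < cmod (z N)" if "N \<in> J" for N using nz that by (simp add: J_def)
    have "cmod (f 0) * R ^ card (z ` J) \<le> (C * exp (s * R powr a)) * (\<Prod>w\<in>z ` J. cmod w)"
      by (rule jensen_inequality) (use J f R z nz C in \<open>auto simp: J_def\<close>)
    also have "card (z ` J) = card J" using z(2) by (intro card_image) (auto simp: inj_on_def inj_def)
    also have "(\<Prod>w\<in>z ` J. cmod w) = (\<Prod>N\<in>J. cmod (z N))"
      using z(2) by (subst prod.reindex) (auto simp: inj_on_def inj_def)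
    finally have le: "cmod (f 0) * (\<Prod>N\<in>J. R / cmod (z N)) \<le> C * exp (s * R powr a)"
      using pos by (simp add: prod_dividef field_simps prod_pos)
    have "ln (\<Prod>N\<in>J. R / cmod (z N)) = (\<Sum>N\<in>J. ln (R / cmod (z N)))"
      using pos R J by (intro ln_prod) auto
    moreover have "(\<Prod>N\<in>J. R / cmod (z N)) > 0" using pos R by (intro prod_pos) auto
    ultimately have "ln (cmod (f 0)) + (\<Sum>N\<in>J. ln (R / cmod (z N))) = ln (cmod (f 0) * (\<Prod>N\<in>J. R / cmod (z N)))"
      using f(2) by (simp add: ln_mult)
    also have "\<dots> \<le> ln (C * exp (s * R powr a))"
      using le f(2) \<open>(\<Prod>N\<in>J. R / cmod (z N)) > 0\<close> by (subst ln_le_cancel_iff) (auto intro!: mult_pos_pos C)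
    also have "\<dots> = ln C + s * R powr a" using C by (simp add: ln_mult)
    finally show "(\<Sum>N | N \<in> I \<and> cmod (z N) < R. ln (R / cmod (z N))) \<le> (ln C - ln (cmod (f 0))) + s * R powr a"
      by (simp add: J_def)
  qed
qed

lemma has_density_facts:
  assumes "has_density z (t, \<delta>)"
  shows "z N \<noteq> 0" and "finite {N. cmod (z N) < R}"
    and "filterlim (\<lambda>N. cmod (z N)) at_top sequentially"
proof -
  have *: "0 < cmod (z 0)" "incseq (\<lambda>N. cmod (z N))" "filterlim (\<lambda>N. cmod (z N)) at_top sequentially"
    using assms by (auto simp: has_density_def)
  have "cmod (z 0) \<le> cmod (z N)" using *(2) by (simp add: incseq_def)
  then show "z N \<noteq> 0" using *(1) by auto
  have "\<forall>\<^sub>F N in sequentially. R \<le> cmod (z N)" using *(3) by (simp add: filterlim_at_top)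
  then obtain N0 where "\<And>N. N \<ge> N0 \<Longrightarrow> R \<le> cmod (z N)" by (auto simp: eventually_sequentially)
  then have "{N. cmod (z N) < R} \<subseteq> {..<N0}" by (metis (mono_tags) lessThan_iff mem_Collect_eq not_le subsetI)
  then show "finite {N. cmod (z N) < R}" using finite_subset by blast
  show "filterlim (\<lambda>N. cmod (z N)) at_top sequentially" by (rule *(3))
qed

lemma count_below_eq_Suc:
  assumes fin: "finite {N. cmod (z N) < R}" and R: "cmod (z 0) < R"
  shows "count_below z R = Suc (card {N \<in> {0<..}. cmod (z N) < R})"
proof -
  have "{N. cmod (z N) < R} = insert 0 {N \<in> {0<..}. cmod (z N) < R}" using R by (auto intro: Suc_lessI)
  then show ?thesis using fin unfolding count_below_def
    by (metis (no_types, lifting) card_insert_disjoint finite_insert greaterThan_iff less_irrefl mem_Collect_eq)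
qed

text \<open>The sum \<open>\<Sum> ln (R / |z\<^sub>N|)\<close> is the integral of \<open>n(u) / u\<close>, so a lower
  bound \<open>n(u) \<ge> d u\<^sup>a\<close> for \<open>u \<ge> u0\<close> can be integrated.\<close>

lemma sum_ln_ge:
  assumes J: "finite J" and u0: "0 < u0" "u0 < R"
    and zJ: "\<And>N. N \<in> J \<Longrightarrow> 0 < cmod (z N) \<and> cmod (z N) < R" and "a > 0"
    and cnt: "\<And>u. u0 \<le> u \<Longrightarrow> u \<le> R \<Longrightarrow> d * u powr a \<le> real (card {N \<in> J. cmod (z N) < u})"
  shows "d * (R powr a - u0 powr a) / a \<le> (\<Sum>N\<in>J. ln (R / cmod (z N)))"
proof -
  define h where "h = (\<lambda>N u. if cmod (z N) < u then 1 / u else (0::real))"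
  \<comment> \<open>Integration starts at \<open>u0\<close>, so a zero closer to the origin
    contributes only \<open>ln R - ln u0\<close>, which is still a lower bound for its term.\<close>
  define m where "m = (\<lambda>N. max u0 (cmod (z N)))"
  have h: "(h N has_integral (ln R - ln (m N))) {u0..R}" if "N \<in> J" for N
  proof -
    have m: "u0 \<le> m N" "m N \<le> R" "0 < m N" "cmod (z N) \<le> m N" using u0 zJ[OF that] by (auto simp: m_def)
    have 1: "((\<lambda>u. 1 / u) has_integral (ln R - ln (m N))) {m N..R}"
      using m by (intro fundamental_theorem_of_calculus)
        (auto intro!: derivative_eq_intros simp: has_real_derivative_iff_has_vector_derivative[symmetric])
    have 2: "(h N has_integral (ln R - ln (m N))) {m N..R}"
      using m by (intro has_integral_spike[OF negligible_sing[of "m N"] _ 1]) (auto simp: h_def)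
    have 3: "(h N has_integral 0) {u0..m N}"
      by (rule has_integral_spike[OF negligible_sing[of u0] _ has_integral_0]) (auto simp: h_def m_def)
    show ?thesis using has_integral_combine[OF m(1,2) 3 2] by simp
  qed
  have 1: "((\<lambda>u. \<Sum>N\<in>J. h N u) has_integral (\<Sum>N\<in>J. ln R - ln (m N))) {u0..R}"
    by (intro has_integral_sum J h)
  have 2: "((\<lambda>u. d * u powr (a - 1)) has_integral (d * R powr a / a - d * u0 powr a / a)) {u0..R}"
  proof (rule fundamental_theorem_of_calculus)
    show "((\<lambda>u. d * u powr a / a) has_vector_derivative d * u powr (a - 1)) (at u within {u0..R})"
      if "u \<in> {u0..R}" for u
      using that u0 \<open>a > 0\<close> unfolding has_real_derivative_iff_has_vector_derivative[symmetric]
      by (auto intro!: derivative_eq_intros)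
  qed (use u0 in auto)
  have "d * R powr a / a - d * u0 powr a / a \<le> (\<Sum>N\<in>J. ln R - ln (m N))"
  proof (rule has_integral_le[OF 2 1])
    fix u assume u: "u \<in> {u0..R}"
    have "(\<Sum>N\<in>J. h N u) = (\<Sum>N\<in>{N \<in> J. cmod (z N) < u}. 1 / u)"
      unfolding h_def by (rule sum.inter_filter[OF J, symmetric])
    also have "\<dots> = real (card {N \<in> J. cmod (z N) < u}) / u" by simp
    also have "\<dots> \<ge> d * u powr a / u" using cnt[of u] u u0 by (intro divide_right_mono) auto
    finally show "d * u powr (a - 1) \<le> (\<Sum>N\<in>J. h N u)" using u u0 by (simp add: powr_diff)
  qed
  also have "\<dots> \<le> (\<Sum>N\<in>J. ln (R / cmod (z N)))"
  proof (rule sum_mono)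
    fix N assume "N \<in> J"
    then show "ln R - ln (m N) \<le> ln (R / cmod (z N))"
      using zJ[of N] u0 by (auto simp: m_def ln_div)
  qed
  finally show ?thesis by (simp add: right_diff_distrib diff_divide_distrib)
qed

text \<open>If \<open>t > a\<close>, each zero within radius \<open>R\<close> contributes at least 1
  to the Jensen sum at radius \<open>exp 1 * R\<close>, so the count is of order at most
  \<open>a\<close>. If \<open>t = a\<close>, integrating a count of at least
  \<open>d * u powr a\<close> over \<open>u\<close> gives the coefficient \<open>d / a\<close>,
  which exceeds \<open>b\<close> exactly when \<open>d > b * a\<close>. Index 0 is left free for the
  deleted state.\<close>

lemma entire_zeros_not_dense:
  assumes f: "f holomorphic_on UNIV" "f 0 \<noteq> 0" and ab: "a > 0" "b > 0"
    and bd: "\<And>s. s > b \<Longrightarrow> exp_bounded s a f"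
    and dens: "has_density z (t, \<delta>)" and "inj z"
    and zeros: "\<And>N. N > 0 \<Longrightarrow> f (z N) = 0"
  shows "\<not> density_less (a, ereal (b * a)) (t, \<delta>)"
proof
  assume less: "density_less (a, ereal (b * a)) (t, \<delta>)"
  define J where "J = (\<lambda>R. {N \<in> {0<..}. cmod (z N) < R})"
  have finJ: "finite (J R)" for R
    unfolding J_def by (rule finite_subset[OF _ has_density_facts(2)[OF dens, of R]]) auto
  have z0: "0 < cmod (z N)" for N using has_density_facts(1)[OF dens] by simp
  have cnt: "real (count_below z R) = real (card (J R)) + 1" if "R > cmod (z 0)" for R
    using count_below_eq_Suc[OF has_density_facts(2)[OF dens] that] by (simp add: J_def)
  have jensen: "\<exists>K. \<forall>R>0. (\<Sum>N\<in>J R. ln (R / cmod (z N))) \<le> K + s * R powr a" if s: "s > b" for s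
  proof -
    have fin: "finite {N \<in> {0<..}. cmod (z N) < R}" for R using finJ[of R] by (simp add: J_def)
    obtain K where "\<And>R. R > 0 \<Longrightarrow> (\<Sum>N | N \<in> {0<..} \<and> cmod (z N) < R. ln (R / cmod (z N))) \<le> K + s * R powr a"
      by (rule jensen_sum_ln_le[OF f bd[OF s] _ \<open>inj z\<close> fin]) (use zeros in auto)
    then show ?thesis by (auto simp: J_def)
  qed
  consider "a < t" | "t = a" "ereal (b * a) < \<delta>" using less by (auto simp: density_less_def)
  then show False
  proof cases
    case 1
    obtain t' where t': "a < t'" "t' < t" using dense[OF 1] by blast
    obtain K where K: "\<And>R. R > 0 \<Longrightarrow> (\<Sum>N\<in>J R. ln (R / cmod (z N))) \<le> K + (b + 1) * R powr a"
      using jensen[of "b + 1"] by auto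
    have le: "real (card (J R)) \<le> K + (b + 1) * (exp 1 * R) powr a" if R: "R > 0" for R
    proof -
      have "real (card (J R)) = (\<Sum>N\<in>J R. 1)" by simp
      also have "\<dots> \<le> (\<Sum>N\<in>J R. ln (exp 1 * R / cmod (z N)))"
      proof (rule sum_mono)
        fix N assume "N \<in> J R"
        then have "R / cmod (z N) \<ge> 1" using z0[of N] by (simp add: J_def)
        then have "ln (R / cmod (z N)) \<ge> 0" by simp
        moreover have "ln (exp 1 * R / cmod (z N)) = 1 + ln (R / cmod (z N))"
          using R z0[of N] by (simp add: ln_div ln_mult)
        ultimately show "1 \<le> ln (exp 1 * R / cmod (z N))" by simp
      qed
      also have "\<dots> \<le> (\<Sum>N\<in>J (exp 1 * R). ln (exp 1 * R / cmod (z N)))"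
      proof (rule sum_mono2[OF finJ])
        have "R \<le> exp 1 * R" using R by simp
        then show "J R \<subseteq> J (exp 1 * R)" by (auto simp: J_def)
        show "0 \<le> ln (exp 1 * R / cmod (z N))" if "N \<in> J (exp 1 * R) - J R" for N
          using that z0[of N] by (intro ln_ge_zero) (auto simp: J_def)
      qed
      also have "\<dots> \<le> K + (b + 1) * (exp 1 * R) powr a" using R by (intro K) simp
      finally show ?thesis .
    qed
    have "\<forall>\<^sub>F R::real in at_top. K + (b + 1) * (exp 1 * R) powr a + 1 < R powr t'"
      using t' ab by real_asymp
    then have "\<forall>\<^sub>F R in at_top. ereal (ln (real (count_below z R)) / ln R) \<le> ereal t'"
      using eventually_gt_at_top[of "max 1 (cmod (z 0))"]
    proof eventually_elim
      case (elim R)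
      have "real (count_below z R) \<le> R powr t'" "real (count_below z R) > 0"
        using elim le[of R] cnt[of R] by auto
      then have "ln (real (count_below z R)) \<le> ln (R powr t')" by (subst ln_le_cancel_iff) auto
      also have "\<dots> = t' * ln R" using elim by (simp add: ln_powr)
      finally show ?case using elim by (simp add: field_simps)
    qed
    then have "Limsup at_top (\<lambda>R. ereal (ln (real (count_below z R)) / ln R)) \<le> ereal t'"
      by (rule Limsup_bounded)
    then show False using dens t' by (simp add: has_density_def)
  next
    case 2
    obtain d' where d': "ereal (b * a) < ereal d'" "ereal d' < \<delta>"
      using ereal_dense2[OF 2(2)] by blast
    then have "b * a < d'" by simp
    \<comment> \<open>The gap between \<open>d\<close> and \<open>d'\<close> absorbs the one term
      lost by omitting index 0.\<close>
    then obtain d where d: "b * a < d" "d < d'" using dense by blast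
    have "((\<lambda>R. ereal (real (count_below z R) / R powr a)) \<longlongrightarrow> \<delta>) at_top"
      using dens 2(1) by (simp add: has_density_def)
    then have "\<forall>\<^sub>F R in at_top. ereal d' < ereal (real (count_below z R) / R powr a)"
      using d'(2) by (rule order_tendstoD)
    moreover have "\<forall>\<^sub>F R::real in at_top. d * R powr a + 1 < d' * R powr a"
      using d ab by real_asymp
    ultimately have "\<forall>\<^sub>F u in at_top. d * u powr a \<le> real (card (J u))"
      using eventually_gt_at_top[of "max 1 (cmod (z 0))"]
    proof eventually_elim
      case (elim u)
      then have "d' * u powr a < real (count_below z u)" by (simp add: field_simps)
      then show ?case using elim cnt[of u] by simp
    qed
    then obtain u1 where u1: "\<And>u. u \<ge> u1 \<Longrightarrow> d * u powr a \<le> real (card (J u))"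
      by (auto simp: eventually_at_top_linorder)
    define u0 where "u0 = max u1 1"
    have "b < d / a" using d ab by (simp add: field_simps)
    then obtain s where s: "b < s" "s < d / a" using dense by blast
    obtain K where K: "\<And>R. R > 0 \<Longrightarrow> (\<Sum>N\<in>J R. ln (R / cmod (z N))) \<le> K + s * R powr a"
      using jensen[OF s(1)] by auto
    have le: "d * (R powr a - u0 powr a) / a \<le> K + s * R powr a" if R: "R > u0" for R
    proof -
      have "d * (R powr a - u0 powr a) / a \<le> (\<Sum>N\<in>J R. ln (R / cmod (z N)))"
      proof (rule sum_ln_ge[OF finJ _ R])
        fix u assume u: "u0 \<le> u" "u \<le> R"
        then have "{N \<in> J R. cmod (z N) < u} = J u" by (auto simp: J_def)
        then show "d * u powr a \<le> real (card {N \<in> J R. cmod (z N) < u})"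
          using u1[of u] u by (simp add: u0_def)
      qed (use z0 ab in \<open>auto simp: J_def u0_def\<close>)
      also have "\<dots> \<le> K + s * R powr a" using R by (intro K) (auto simp: u0_def)
      finally show ?thesis .
    qed
    have "\<forall>\<^sub>F R in at_top. K + s * R powr a < d * (R powr a - u0 powr a) / a"
    proof -
      have "\<forall>\<^sub>F R in at_top. K + d * u0 powr a / a < (d / a - s) * R powr a"
        using s ab by real_asymp
      then show ?thesis by eventually_elim (simp add: algebra_simps diff_divide_distrib)
    qed
    then have "\<forall>\<^sub>F R::real in at_top. False"
      using eventually_gt_at_top[of u0]
    proof eventually_elim
      case (elim R)
      then show ?case using le[of R] by linarith
    qed
    then show False by simp
  qed
qed

section \<open>An entire function of small growth vanishing on a sequence\<close>

text \<open>Small \<open>x\<close> are at most \<open>x powr \<sigma>\<close>, and for large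
  \<open>x\<close> the logarithm of \<open>x powr \<sigma>\<close>, divided by
  \<open>\<sigma>\<close>, bounds \<open>ln x\<close>. With it a factor of the product is bounded by
  a power matching the order of the zeros instead of the integer \<open>k\<close>.\<close>

lemma one_plus_le_exp_powr:
  fixes x :: real
  assumes "x \<ge> 0" "0 < \<sigma>" "\<sigma> \<le> 1"
  shows "1 + x \<le> exp ((1 + 1 / \<sigma>) * x powr \<sigma>)"
proof (cases "x \<le> 1")
  case True
  have "x \<le> x powr \<sigma>"
  proof (cases "x = 0")
    case False
    then have "x powr 1 \<le> x powr \<sigma>" using True assms by (intro powr_mono') auto
    then show ?thesis using assms by simp
  qed simp
  also have "\<dots> \<le> (1 + 1 / \<sigma>) * x powr \<sigma>"
    using assms by (simp add: mult_le_cancel_right1)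
  finally show ?thesis using exp_ge_add_one_self[of x] by (smt (verit) exp_le_cancel_iff)
next
  case False
  define y where "y = x powr \<sigma>"
  have y: "y \<ge> 1" using False assms by (simp add: y_def ge_one_powr_ge_zero)
  have "ln x = ln y / \<sigma>" using False assms by (simp add: y_def ln_powr)
  also have "\<dots> \<le> (y - 1) / \<sigma>" using y assms by (intro divide_right_mono ln_le_minus_one) auto
  also have "\<dots> \<le> y / \<sigma>" using assms by (intro divide_right_mono) auto
  finally have lnx: "ln x \<le> y / \<sigma>" .
  have "1 + x \<le> 2 * x" using False by simp
  also have "\<dots> \<le> exp 1 * exp (y / \<sigma>)"
  proof (intro mult_mono)
    show "(2::real) \<le> exp 1" using exp_ge_add_one_self[of 1] by simp
    show "x \<le> exp (y / \<sigma>)" using lnx False by (metis exp_le_cancel_iff exp_ln linorder_not_le order_less_trans zero_less_one)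
  qed (use False in auto)
  also have "\<dots> = exp (1 + y / \<sigma>)" by (simp add: exp_add)
  also have "\<dots> \<le> exp ((1 + 1 / \<sigma>) * y)" using y by (simp add: algebra_simps)
  finally show ?thesis by (simp add: y_def)
qed

text \<open>At least \<open>Suc N\<close> terms lie within \<open>2 * cmod (z N)\<close>, while the
  count is below \<open>R powr t'\<close>. So the terms are compared with
  \<open>real (Suc N) powr (- \<tau> / t')\<close>, whose exponent is below -1.\<close>

lemma summable_inverse_powr_of_density:
  assumes dens: "has_density z (t, \<delta>)" and "t < \<tau>" "\<tau> > 0"
  shows "summable (\<lambda>N. 1 / cmod (z N) powr \<tau>)"
proof -
  note facts = has_density_facts[OF dens]
  \<comment> \<open>The maximum with 0 makes \<open>t'\<close> positive at once, without a sign
    argument for \<open>t\<close>.\<close>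
  define t' where "t' = (max t 0 + \<tau>) / 2"
  have t': "t < t'" "0 < t'" "t' < \<tau>" using assms(2,3) by (auto simp: t'_def)
  have inc: "incseq (\<lambda>N. cmod (z N))" using dens by (simp add: has_density_def)
  have "Limsup at_top (\<lambda>R. ereal (ln (real (count_below z R)) / ln R)) < ereal t'"
    using dens t' by (simp add: has_density_def)
  then have "\<forall>\<^sub>F R in at_top. ln (real (count_below z R)) / ln R < t'" by (auto dest: Limsup_lessD)
  then obtain R0 where R0: "\<And>R. R \<ge> R0 \<Longrightarrow> ln (real (count_below z R)) / ln R < t'"
    by (auto simp: eventually_at_top_linorder)
  have ev: "\<forall>\<^sub>F N in sequentially. max R0 1 \<le> cmod (z N)"
    using facts(3) unfolding filterlim_at_top by blast
  define p where "p = \<tau> / t'"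
  have p: "p > 1" using t' by (simp add: p_def)
  have "summable (\<lambda>n. real n powr (- p))" using p by (simp add: summable_real_powr_iff)
  then have "summable (\<lambda>n. real (Suc n) powr (- p))" by (subst summable_Suc_iff)
  then have sm: "summable (\<lambda>n. 2 powr \<tau> * real (Suc n) powr (- p))" by (rule summable_mult)
  show ?thesis
  proof (rule summable_comparison_test_ev[OF _ sm])
    show "\<forall>\<^sub>F N in sequentially. norm (1 / cmod (z N) powr \<tau>) \<le> 2 powr \<tau> * real (Suc N) powr (- p)"
      using ev
    proof eventually_elim
      case (elim N)
      \<comment> \<open>The count is over a strict inequality, so the radius is enlarged to include
        \<open>z N\<close> itself.\<close>
      define R where "R = 2 * cmod (z N)"
      have R: "R \<ge> R0" "R > 1" using elim by (auto simp: R_def)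
      have "{..N} \<subseteq> {M. cmod (z M) < R}"
      proof
        fix M assume "M \<in> {..N}"
        then have "cmod (z M) \<le> cmod (z N)" using inc by (simp add: incseq_def)
        also have "\<dots> < R" using facts(1)[of N] by (simp add: R_def)
        finally show "M \<in> {M. cmod (z M) < R}" by simp
      qed
      then have "card {..N} \<le> count_below z R"
        unfolding count_below_def by (intro card_mono facts)
      then have c: "real (Suc N) \<le> real (count_below z R)" by simp
      have "ln (real (count_below z R)) < t' * ln R"
        using R0[OF R(1)] R(2) by (simp add: field_simps)
      also have "\<dots> = ln (R powr t')" using R by (simp add: ln_powr)
      finally have "real (count_below z R) < R powr t'"
        using c R by (subst (asm) ln_less_cancel_iff) auto
      with c have "real (Suc N) \<le> R powr t'" by linarith
      then have "real (Suc N) powr p \<le> (R powr t') powr p" using p by (intro powr_mono2) auto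
      also have "\<dots> = R powr \<tau>" using t' by (simp add: powr_powr p_def)
      also have "\<dots> = 2 powr \<tau> * cmod (z N) powr \<tau>" by (simp add: R_def powr_mult)
      finally have "real (Suc N) powr p \<le> 2 powr \<tau> * cmod (z N) powr \<tau>" .
      moreover have "cmod (z N) powr \<tau> > 0" "real (Suc N) powr p > 0" using facts(1)[of N] by auto
      ultimately show ?case by (simp add: powr_minus field_simps del: of_nat_Suc)
    qed
  qed
qed

text \<open>Taking \<open>1 - (z / z\<^sub>N)\<^sup>k\<close> as the factors makes the product converge without the
  exponential factors of the Weierstrass product; the superfluous zeros do no harm.\<close>

lemma entire_with_zeros:
  assumes dens: "has_density z (t, \<delta>)" and "t < a" "a > 0" "s > 0"
  obtains f where "f holomorphic_on UNIV" "f 0 = 1" "\<And>N. f (z N) = 0" "exp_bounded s a f"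
proof -
  note facts = has_density_facts[OF dens]
  \<comment> \<open>The product will grow at most like \<open>exp (B * r powr \<tau>)\<close>; since
    \<open>\<tau> < a\<close>, this is eventually below every prescribed type
    \<open>s\<close>.\<close>
  define \<tau> where "\<tau> = (max t 0 + a) / 2"
  have \<tau>: "t < \<tau>" "0 < \<tau>" "\<tau> < a" using assms(2,3) by (auto simp: \<tau>_def)
  have sm\<tau>: "summable (\<lambda>N. 1 / cmod (z N) powr \<tau>)"
    by (rule summable_inverse_powr_of_density[OF dens \<tau>(1,2)])
  obtain k where k: "\<tau> \<le> real k" "k > 0"
    using real_arch_simple[of \<tau>] \<tau> by (metis gr0I not_le of_nat_0)
  have smk: "summable (\<lambda>N. 1 / cmod (z N) ^ k)"
  proof (rule summable_comparison_test_ev[OF _ sm\<tau>])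
    have "\<forall>\<^sub>F N in sequentially. 1 \<le> cmod (z N)" using facts(3) by (simp add: filterlim_at_top)
    then show "\<forall>\<^sub>F N in sequentially. norm (1 / cmod (z N) ^ k) \<le> 1 / cmod (z N) powr \<tau>"
    proof eventually_elim
      case (elim N)
      then have "cmod (z N) powr \<tau> \<le> cmod (z N) powr k" using k by (intro powr_mono) auto
      also have "\<dots> = cmod (z N) ^ k" using elim by (intro powr_realpow) auto
      finally have "1 / cmod (z N) ^ k \<le> 1 / cmod (z N) powr \<tau>"
        using facts(1)[of N] by (intro divide_left_mono mult_pos_pos) auto
      then show ?case by simp
    qed
  qed
  define g where "g = (\<lambda>N w. 1 - (w / z N) ^ k)"
  define P where "P = (\<lambda>N w. \<Prod>n<N. g n w)"
  define f where "f = (\<lambda>w. lim (\<lambda>N. P N w))"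
  have unif: "uniform_limit (cball 0 R) P f sequentially" for R
  proof -
    have "uniformly_convergent_on (cball 0 R) (\<lambda>N w. \<Prod>n<N. g n w)"
    proof (rule uniformly_convergent_on_prod')
      show "continuous_on (cball 0 R) (g n)" for n
        unfolding g_def using facts(1) by (intro continuous_intros) auto
      have "uniform_limit (cball 0 R) (\<lambda>N w. \<Sum>n<N. norm (g n w - 1)) (\<lambda>w. \<Sum>n. norm (g n w - 1)) sequentially"
      proof (rule Weierstrass_m_test)
        show "norm (norm (g n w - 1)) \<le> \<bar>R\<bar> ^ k * (1 / cmod (z n) ^ k)" if "w \<in> cball 0 R" for n w
          using that power_mono[of "cmod w" "\<bar>R\<bar>" k]
          by (auto simp: g_def norm_power norm_divide power_divide intro!: divide_right_mono)
        show "summable (\<lambda>n. \<bar>R\<bar> ^ k * (1 / cmod (z n) ^ k))" by (rule summable_mult[OF smk])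
      qed
      then show "uniformly_convergent_on (cball 0 R) (\<lambda>N w. \<Sum>n<N. norm (g n w - 1))"
        by (auto simp: uniformly_convergent_on_def)
    qed auto
    then show ?thesis by (simp add: uniformly_convergent_uniform_limit_iff P_def f_def)
  qed
  have lim: "(\<lambda>N. P N w) \<longlonglongrightarrow> f w" for w
    using tendsto_uniform_limitI[OF unif[of "cmod w"], of w] by simp
  have hol: "f holomorphic_on UNIV"
  proof (rule holomorphic_uniform_sequence[of UNIV P])
    show "P n holomorphic_on UNIV" for n
      unfolding P_def g_def by (intro holomorphic_intros) (use facts(1) in auto)
    show "\<exists>d>0. cball x d \<subseteq> UNIV \<and> uniform_limit (cball x d) P f sequentially" for x
    proof (intro exI[of _ 1] conjI)
      have "cball x 1 \<subseteq> cball 0 (cmod x + 1)"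
      proof
        fix y assume "y \<in> cball x 1"
        then show "y \<in> cball 0 (cmod x + 1)"
          using norm_triangle_sub[of y x] by (simp add: dist_norm norm_minus_commute)
      qed
      then show "uniform_limit (cball x 1) P f sequentially"
        by (rule uniform_limit_on_subset[OF unif])
    qed auto
  qed auto
  have "(\<lambda>N. P N 0) = (\<lambda>N. 1)" using k by (simp add: P_def g_def fun_eq_iff zero_power)
  then have f0: "f 0 = 1" using lim[of 0] LIMSEQ_unique tendsto_const by metis
  have fz: "f (z N) = 0" for N
  proof -
    have "P M (z N) = 0" if "M > N" for M
      unfolding P_def using that facts(1)[of N] by (intro prod_zero bexI[of _ N]) (auto simp: g_def)
    then have "\<forall>\<^sub>F M in sequentially. P M (z N) = 0"
      by (intro eventually_mono[OF eventually_gt_at_top[of N]])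
    then have "(\<lambda>M. P M (z N)) \<longlonglongrightarrow> 0" by (rule tendsto_eventually)
    then show ?thesis using lim LIMSEQ_unique by blast
  qed
  \<comment> \<open>Chosen so that \<open>(x ^ k) powr \<sigma> = x powr \<tau>\<close>; the
    condition \<open>\<tau> \<le> k\<close> makes it at most 1.\<close>
  define \<sigma> where "\<sigma> = \<tau> / k"
  have \<sigma>: "0 < \<sigma>" "\<sigma> \<le> 1" using \<tau> k by (auto simp: \<sigma>_def field_simps)
  define S where "S = (\<Sum>N. 1 / cmod (z N) powr \<tau>)"
  define B where "B = (1 + 1 / \<sigma>) * S"
  have bound: "cmod (f w) \<le> exp (B * cmod w powr \<tau>)" for w
  proof (rule Lim_norm_ubound[OF _ lim])
    have "cmod (P N w) \<le> exp (B * cmod w powr \<tau>)" for N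
    proof -
      have fac: "cmod (g n w) \<le> exp ((1 + 1 / \<sigma>) * (cmod w powr \<tau> * (1 / cmod (z n) powr \<tau>)))" for n
      proof -
        define x where "x = cmod w / cmod (z n)"
        have x: "x \<ge> 0" by (simp add: x_def)
        have "cmod (g n w) \<le> 1 + x ^ k"
          unfolding g_def x_def using norm_triangle_ineq4[of 1 "(w / z n) ^ k"]
          by (simp add: norm_power norm_divide)
        also have "\<dots> \<le> exp ((1 + 1 / \<sigma>) * (x ^ k) powr \<sigma>)"
          using x \<sigma> by (intro one_plus_le_exp_powr) auto
        also have "(x ^ k) powr \<sigma> = x powr \<tau>"
          using x k by (cases "x = 0") (auto simp: powr_powr \<sigma>_def simp flip: powr_realpow)
        also have "\<dots> = cmod w powr \<tau> * (1 / cmod (z n) powr \<tau>)"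
          by (simp add: x_def powr_divide)
        finally show ?thesis .
      qed
      have "cmod (P N w) = (\<Prod>n<N. cmod (g n w))" by (simp add: P_def prod_norm)
      also have "\<dots> \<le> (\<Prod>n<N. exp ((1 + 1 / \<sigma>) * (cmod w powr \<tau> * (1 / cmod (z n) powr \<tau>))))"
        by (intro prod_mono conjI fac) auto
      also have "\<dots> = exp (\<Sum>n<N. (1 + 1 / \<sigma>) * (cmod w powr \<tau> * (1 / cmod (z n) powr \<tau>)))"
        by (simp add: exp_sum)
      also have "(\<Sum>n<N. (1 + 1 / \<sigma>) * (cmod w powr \<tau> * (1 / cmod (z n) powr \<tau>))) =
          (1 + 1 / \<sigma>) * (cmod w powr \<tau> * (\<Sum>n<N. 1 / cmod (z n) powr \<tau>))"
        by (simp only: sum_distrib_left)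
      also have "\<dots> \<le> (1 + 1 / \<sigma>) * (cmod w powr \<tau> * S)"
        unfolding S_def using \<sigma> by (intro mult_left_mono sum_le_suminf sm\<tau>) auto
      finally show ?thesis by (simp add: B_def mult_ac)
    qed
    then show "\<forall>\<^sub>F N in sequentially. cmod (P N w) \<le> exp (B * cmod w powr \<tau>)" by simp
  qed auto
  have "\<forall>\<^sub>F r in at_top. B * r powr \<tau> \<le> s * r powr a"
  proof -
    have "((\<lambda>r. B * r powr (\<tau> - a)) \<longlongrightarrow> 0) at_top" using \<tau> by real_asymp
    then have "\<forall>\<^sub>F r in at_top. B * r powr (\<tau> - a) < s" using \<open>s > 0\<close> by (rule order_tendstoD)
    then show ?thesis using eventually_gt_at_top[of 0]
      by eventually_elim (simp add: powr_diff field_simps)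
  qed
  then obtain R0 where R0: "\<And>r. r \<ge> R0 \<Longrightarrow> B * r powr \<tau> \<le> s * r powr a"
    by (auto simp: eventually_at_top_linorder)
  have bd: "exp_bounded s a f"
  proof (rule exp_boundedI_eventually)
    show "continuous_on UNIV f" by (rule holomorphic_on_imp_continuous_on[OF hol])
    show "cmod (f w) \<le> 1 * exp (s * cmod w powr a)" if "cmod w \<ge> R0" for w
      using order_trans[OF bound[of w]] R0[OF that] by simp
  qed (use \<open>s > 0\<close> in auto)
  show ?thesis by (rule that[OF hol f0 fz bd])
qed

section \<open>Completeness of sequences of coherent states\<close>

context coherent_states
begin

text \<open>Jensen's inequality needs a nonzero value at the origin, so the representing function is
  divided by its exact power \<open>w ^ m\<close>. This keeps the growth bound outside the unit disc
  and the zeros \<open>z N\<close>, which are not 0.\<close>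

lemma orthogonal_dense_sequence_imp_zero:
  assumes dens: "has_density z (t, \<delta>)" and "inj z" and less: "density_less (a, ereal (b * a)) (t, \<delta>)"
    and orth: "\<And>N. N > 0 \<Longrightarrow> cinner (coherent_state scaleC e \<rho> (z N)) x = 0"
  shows "x = 0"
proof (rule ccontr)
  assume "x \<noteq> 0"
  define c where "c = (\<lambda>n. cinner x (e n) / complex_of_real (sqrt (\<rho> n)))"
  define F where "F = (\<lambda>z. \<Sum>n. c n * z ^ n)"
  have F: "(\<lambda>n. c n * w ^ n) sums F w" "s > b \<Longrightarrow> exp_bounded s a F" for w s
    using coherent_symbol[of F x] unfolding F_def c_def by blast+
  have ex: "\<exists>n. c n \<noteq> 0"
    using orthogonal_basis_imp_zero[of x] \<open>x \<noteq> 0\<close> \<rho>_pos by (auto simp: c_def less_le)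
  define m where "m = (LEAST n. c n \<noteq> 0)"
  have cm: "c m \<noteq> 0" unfolding m_def by (rule LeastI_ex[OF ex])
  have c0: "c n = 0" if "n < m" for n using not_less_Least[of n "\<lambda>n. c n \<noteq> 0"] that by (auto simp: m_def)
  define G where "G = (\<lambda>w. if w = 0 then c m else F w / w ^ m)"
  have sumsG: "(\<lambda>n. c (n + m) * w ^ n) sums G w" for w
  proof (cases "w = 0")
    case True
    have "(\<lambda>n. c (n + m) * w ^ n) = (\<lambda>n. if n = 0 then c m else 0)" using True by (auto simp: fun_eq_iff)
    then show ?thesis using sums_single[of 0 "\<lambda>_. c m"] True by (simp add: G_def)
  next
    case False
    have "(\<lambda>n. c (n + m) * w ^ (n + m)) sums (F w - (\<Sum>n<m. c n * w ^ n))"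
      by (rule sums_split_initial_segment[OF F(1)])
    then have "(\<lambda>n. c (n + m) * w ^ (n + m)) sums F w" by (simp add: c0)
    from sums_divide[OF this, of "w ^ m"] show ?thesis
      using False by (simp add: power_add G_def)
  qed
  have hol: "G holomorphic_on UNIV" by (rule entire_power_series_holomorphic[OF sumsG])
  have bd: "exp_bounded s a G" if s: "s > b" for s
  proof -
    obtain C where C: "\<And>w. cmod (F w) \<le> C * exp (s * cmod w powr a)"
      using F(2)[OF s] by (auto simp: exp_bounded_def)
    show ?thesis
    proof (rule exp_boundedI_eventually)
      show "cmod (G w) \<le> C * exp (s * cmod w powr a)" if "1 \<le> cmod w" for w
      proof -
        have "cmod (G w) = cmod (F w) / cmod w ^ m" using that by (auto simp: G_def norm_divide norm_power)
        also have "\<dots> \<le> cmod (F w) / 1" 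
          using that by (intro divide_left_mono mult_pos_pos) (auto simp: one_le_power intro!: zero_less_power)
        finally show ?thesis using C[of w] by simp
      qed
    qed (use holomorphic_on_imp_continuous_on[OF hol] s b_pos in auto)
  qed
  have zero: "G (z N) = 0" if "N > 0" for N
  proof -
    have "F (z N) = 0"
      using orth[OF that] unfolding cinner_coherent_state_zero_iff F_def c_def .
    then show ?thesis using has_density_facts(1)[OF dens, of N] by (simp add: G_def)
  qed
  have "G 0 \<noteq> 0" using cm by (simp add: G_def)
  from entire_zeros_not_dense[OF hol this a_pos b_pos bd dens \<open>inj z\<close> zero] less
  show False by blast
qed

text \<open>Totality is proved directly for the set without the state of index 0, and passes to the
  larger set.\<close>

theorem overcomplete_coherent_states:
  assumes "has_density z (t, \<delta>)" "inj z" "density_less (a, ereal (b * a)) (t, \<delta>)"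
  shows "overcomplete cinner (range (\<lambda>N. coherent_state scaleC e \<rho> (z N)))"
proof -
  define S where "S = range (\<lambda>N. coherent_state scaleC e \<rho> (z N))"
  define u where "u = coherent_state scaleC e \<rho> (z 0)"
  have mem: "coherent_state scaleC e \<rho> (z N) \<in> S - {u}" if "N > 0" for N
    using that injD[OF inj_coherent_state] injD[OF assms(2)] by (force simp: S_def u_def)
  have "x = 0" if "\<forall>s\<in>S - {u}. cinner s x = 0" for x
    using that mem by (intro orthogonal_dense_sequence_imp_zero[OF assms]) blast
  then have "total_states cinner (S - {u})" "total_states cinner S"
    unfolding total_states_def by blast+
  moreover have "u \<in> S" by (simp add: S_def u_def)
  ultimately show ?thesis unfolding overcomplete_def S_def by blast
qed

text \<open>A function of small growth vanishing at all \<open>z N\<close> has coefficients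
  \<open>p n\<close> with \<open>p n * sqrt (\<rho> n)\<close> decaying geometrically, so these
  numbers, conjugated, are the components of a norm convergent series orthogonal to every
  state.\<close>

theorem undercomplete_coherent_states:
  assumes dens: "has_density z (t, \<delta>)" and "t < a"
  shows "undercomplete cinner (range (\<lambda>N. coherent_state scaleC e \<rho> (z N)))"
proof -
  \<comment> \<open>In Cauchy's estimate at radius \<open>2 * sqrt x\<close> this gives the exponent
    \<open>b / 2 * x powr (a / 2)\<close>, whose double is integrable against the weight. The factor
    2 in the radius yields \<open>4 ^ n\<close>, the source of the geometric decay.\<close>
  define s where "s = b / (2 * 2 powr a)"
  have s: "s > 0" "s * 2 powr a = b / 2" using b_pos by (auto simp: s_def)
  obtain f where f: "f holomorphic_on UNIV" "f 0 = 1" "\<And>N. f (z N) = 0" "exp_bounded s a f"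
    using entire_with_zeros[OF dens \<open>t < a\<close> a_pos s(1)] by blast
  obtain C where C: "\<And>w. cmod (f w) \<le> C * exp (s * cmod w powr a)"
    using f(4) by (auto simp: exp_bounded_def)
  obtain p where p: "\<And>w. (\<lambda>n. p n * w ^ n) sums f w" using entire_power_series[OF f(1)] by blast
  have p_le: "(cmod (p n))\<^sup>2 * 4 ^ n * x ^ n \<le> C\<^sup>2 * exp (2 * (b / 2) * x powr (a / 2))" if x: "x > 0" for x n
  proof -
    have "cmod (p n) * (2 * sqrt x) ^ n \<le> C * exp (s * (2 * sqrt x) powr a)"
    proof (rule coeff_power_le[OF p])
      show "cmod (f w) \<le> C * exp (s * (2 * sqrt x) powr a)" if "cmod w = 2 * sqrt x" for w
        using C[of w] that by simp
    qed (use x in auto)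
    also have "s * (2 * sqrt x) powr a = b / 2 * x powr (a / 2)"
      using x s(2) by (simp add: powr_mult powr_powr flip: powr_half_sqrt mult.assoc)
    finally have "(cmod (p n) * (2 * sqrt x) ^ n)\<^sup>2 \<le> (C * exp (b / 2 * x powr (a / 2)))\<^sup>2"
      using x by (intro power_mono) auto
    moreover have "(cmod (p n) * (2 * sqrt x) ^ n)\<^sup>2 = (cmod (p n))\<^sup>2 * 4 ^ n * x ^ n"
    proof -
      have "((2 * sqrt x) ^ n)\<^sup>2 = ((2 * sqrt x)\<^sup>2) ^ n" by (simp only: power_mult[symmetric] mult.commute)
      also have "(2 * sqrt x)\<^sup>2 = 4 * x" using x by (simp add: power_mult_distrib)
      finally show ?thesis by (simp add: power_mult_distrib)
    qed
    moreover have "(C * exp (b / 2 * x powr (a / 2)))\<^sup>2 = C\<^sup>2 * exp (2 * (b / 2) * x powr (a / 2))"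
      by (simp only: power_mult_distrib exp_double[symmetric] mult.assoc)
    ultimately show ?thesis by simp
  qed
  define L where "L = (\<integral>\<^sup>+ x. ennreal (W' x * exp (2 * (b / 2) * x powr (a / 2))) * indicator {0<..} x \<partial>lborel)"
  have "L < \<infinity>" unfolding L_def by (rule nn_integral_exp_W'_finite) (use b_pos in auto)
  then obtain l where l: "l \<ge> 0" "L = ennreal l" by (cases L) auto
  have moment: "(cmod (p n))\<^sup>2 * 4 ^ n * \<rho> n \<le> C\<^sup>2 * l" for n
  proof -
    have "ennreal ((cmod (p n))\<^sup>2 * 4 ^ n * \<rho> n) = ennreal ((cmod (p n))\<^sup>2 * 4 ^ n) * ennreal (\<rho> n)"
      by (intro ennreal_mult') auto
    also have "\<dots> = (\<integral>\<^sup>+ x. ennreal ((cmod (p n))\<^sup>2 * 4 ^ n) * (ennreal (W' x * x ^ n) * indicator {0<..} x) \<partial>lborel)"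
      unfolding nn_integral_moment[symmetric] by (rule nn_integral_cmult[symmetric]) simp
    also have "\<dots> \<le> (\<integral>\<^sup>+ x. ennreal (C\<^sup>2) * (ennreal (W' x * exp (2 * (b / 2) * x powr (a / 2))) * indicator {0<..} x) \<partial>lborel)"
    proof (rule nn_integral_mono)
      fix x :: real
      show "ennreal ((cmod (p n))\<^sup>2 * 4 ^ n) * (ennreal (W' x * x ^ n) * indicator {0<..} x) \<le>
          ennreal (C\<^sup>2) * (ennreal (W' x * exp (2 * (b / 2) * x powr (a / 2))) * indicator {0<..} x)"
      proof (cases "x > 0")
        case True
        have "W' x * ((cmod (p n))\<^sup>2 * 4 ^ n * x ^ n) \<le> W' x * (C\<^sup>2 * exp (2 * (b / 2) * x powr (a / 2)))"
          by (intro mult_left_mono p_le[OF True] W'(2))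
        then have "ennreal ((cmod (p n))\<^sup>2 * 4 ^ n * (W' x * x ^ n)) \<le> ennreal (C\<^sup>2 * (W' x * exp (2 * (b / 2) * x powr (a / 2))))"
          by (intro ennreal_leI) (simp only: mult_ac)
        then show ?thesis using True by (simp only: ennreal_mult' zero_le_power2 zero_le_power
              zero_le_numeral mult_nonneg_nonneg indicator_simps greaterThan_iff mult_1_right)
      qed auto
    qed
    also have "\<dots> = ennreal (C\<^sup>2) * L" unfolding L_def by (rule nn_integral_cmult) simp
    also have "\<dots> = ennreal (C\<^sup>2 * l)" using l by (simp add: ennreal_mult')
    finally show ?thesis using l by (subst (asm) ennreal_le_iff) auto
  qed
  have p_bd: "cmod (p n) * sqrt (\<rho> n) \<le> sqrt (C\<^sup>2 * l) * (1 / 2) ^ n" for n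
  proof -
    have "sqrt ((cmod (p n))\<^sup>2 * 4 ^ n * \<rho> n) \<le> sqrt (C\<^sup>2 * l)" using moment by simp
    moreover have "sqrt ((4::real) ^ n) = 2 ^ n" by (simp add: real_sqrt_power)
    ultimately show ?thesis by (simp add: real_sqrt_mult field_simps)
  qed
  \<comment> \<open>The conjugate compensates for the conjugate linearity of \<open>cinner\<close>
    in its first argument.\<close>
  define x where "x = (\<Sum>n. scaleC (cnj (p n) * of_real (sqrt (\<rho> n))) (e n))"
  have sm: "summable (\<lambda>n. scaleC (cnj (p n) * of_real (sqrt (\<rho> n))) (e n))"
  proof (rule summable_comparison_test'[where g = "\<lambda>n. sqrt (C\<^sup>2 * l) * (1 / 2) ^ n"])
    show "summable (\<lambda>n. sqrt (C\<^sup>2 * l) * (1 / 2) ^ n)" by (intro summable_mult summable_geometric) simp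
    show "norm (scaleC (cnj (p n) * of_real (sqrt (\<rho> n))) (e n)) \<le> sqrt (C\<^sup>2 * l) * (1 / 2) ^ n" if "n \<ge> 0" for n
      using p_bd[of n] \<rho>_pos[of n] by (simp add: norm_scaleC norm_basis norm_mult)
  qed
  have coef: "cinner x (e m) = p m * of_real (sqrt (\<rho> m))" for m
  proof -
    have "cinner (e m) x = (\<Sum>n. cinner (e m) (scaleC (cnj (p n) * of_real (sqrt (\<rho> n))) (e n)))"
      unfolding x_def by (rule bounded_linear.suminf[OF bounded_linear_cinner sm])
    also have "(\<lambda>n. cinner (e m) (scaleC (cnj (p n) * of_real (sqrt (\<rho> n))) (e n))) =
        (\<lambda>n. if n = m then cnj (p m) * of_real (sqrt (\<rho> m)) else 0)"
      by (auto simp: cinner_scaleC_right orthonormal fun_eq_iff)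
    also have "(\<Sum>n. if n = m then cnj (p m) * of_real (sqrt (\<rho> m)) else 0) = cnj (p m) * of_real (sqrt (\<rho> m))"
      using sums_unique[OF sums_single[of m "\<lambda>_. cnj (p m) * complex_of_real (sqrt (\<rho> m))"]] by simp
    finally show ?thesis using cinner_commute[of x "e m"] by simp
  qed
  have "p 0 = 1"
    using sums_unique2[OF powser_sums_zero p[of 0]] f(2) by simp
  then have "cinner x (e 0) \<noteq> 0" using coef[of 0] \<rho>_pos[of 0] by simp
  then have "x \<noteq> 0" by (auto simp: cinner_zero_left)
  moreover have "cinner (coherent_state scaleC e \<rho> (z N)) x = 0" for N
  proof -
    have "cinner x (e n) / complex_of_real (sqrt (\<rho> n)) = p n" for n
      using coef[of n] \<rho>_pos[of n] by simp
    then show ?thesis unfolding cinner_coherent_state_zero_iff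
      using sums_unique[OF p[of "z N"]] f(3)[of N] by simp
  qed
  ultimately show ?thesis unfolding undercomplete_def by blast
qed

end

text \<open>Since the density counts terms with repetition, repeated terms would raise it without
  enlarging the set of states; \<open>inj z\<close> makes the two agree in the overcompleteness
  claim. The remark on critical growth is rendered by one function inside the space and one
  outside.\<close>

theorem mainTheorem1:
  fixes scaleC :: "complex \<Rightarrow> 'h::banach \<Rightarrow> 'h"
    and cinner :: "'h \<Rightarrow> 'h \<Rightarrow> complex"
    and e :: "nat \<Rightarrow> 'h"
    and \<rho> :: "nat \<Rightarrow> real"
    and W :: "real \<Rightarrow> real"
    and \<aa> \<bb> :: real
  assumes "complex_hilbert_onb scaleC cinner e"
    and "\<And>n. \<rho> n > 0" and "\<rho> 0 = 1"
    and "\<And>x. x \<ge> 0 \<Longrightarrow> summable (\<lambda>n. x ^ n / \<rho> n)"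
    and "\<And>x. x > 0 \<Longrightarrow> W x > 0"
    and "\<And>n. set_integrable lebesgue {0<..} (\<lambda>x. x ^ n * W x)"
    and "\<And>n. (LINT x:{0<..}|lebesgue. x ^ n * W x) = \<rho> n"
    and "\<aa> > 0" and "\<bb> > 0"
    and "((\<lambda>z::complex. ln (W ((cmod z)\<^sup>2)) / (- 2 * \<bb> * cmod z powr \<aa>)) \<longlongrightarrow> 1) at_infinity"
  shows
    "(growth_less \<aa> \<bb> \<subseteq> bargmann_space W \<and> bargmann_space W \<subseteq> growth_le \<aa> \<bb> \<and>
      (\<exists>F. F holomorphic_on UNIV \<and> growth_order F = ereal \<aa> \<and> growth_type \<aa> F = ereal \<bb> \<and>
           F \<in> bargmann_space W) \<and>
      (\<exists>F. F holomorphic_on UNIV \<and> growth_order F = ereal \<aa> \<and> growth_type \<aa> F = ereal \<bb> \<and>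
           F \<notin> bargmann_space W)) \<and>
     (\<forall>(z :: nat \<Rightarrow> complex) t \<delta>. has_density z (t, \<delta>) \<longrightarrow>
        (inj z \<and> density_less (\<aa>, ereal (\<bb> * \<aa>)) (t, \<delta>) \<longrightarrow>
           overcomplete cinner (range (\<lambda>N. coherent_state scaleC e \<rho> (z N)))) \<and>
        (t < \<aa> \<longrightarrow>
           undercomplete cinner (range (\<lambda>N. coherent_state scaleC e \<rho> (z N)))))"
proof -
  interpret coherent_states scaleC cinner e \<rho> W \<aa> \<bb>
    by (intro coherent_states.intro log_asymptotic_weight.intro coherent_states_axioms.intro)
       (fact assms)+
  show ?thesis
    using bargmann_growth overcomplete_coherent_states undercomplete_coherent_states by blast
qed

end
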